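(* Let $P$ be a symmetric operad in $\mathbf{Cat}$. The 2-monad $\underline P$ on $\mathbf{Cat}$ associated to $P$ is (2-)cartesian if and only if the action of $\Sigma_n$ on $P(n)$ is free for each $n$.
   Context: A symmetric operad $P$ in $\mathbf{Cat}$: small categories $P(n)$ ($n\in\mathbb N$, $0\in\mathbb N$) with strict right actions of the symmetric groups $\Sigma_n$ by functors, an object $\mathrm{id}\in P(1)$, and functors $\mu:P(n)\times P(k_1)\times\cdots\times P(k_n)\to P(k_1+\cdots+k_n)$, strictly unital and associative and equivariant: $\mu(p;q_1\cdot\tau_1,\dots,q_n\cdot\tau_n)=\mu(p;q_1,\dots,q_n)\cdot\beta(\tau_1,\dots,\tau_n)$ and $\mu(p\cdot\sigma;q_1,\dots,q_n)=\mu(p;q_{\sigma^{-1}(1)},\dots,q_{\sigma^{-1}(n)})\cdot\delta_{n;k_1,\dots,k_n}(\sigma)$, for $q_i$ in $P(k_i)$. Here $\beta$ is the block sum of permutations, and $\delta_{n;k_1,\dots,k_n}(\sigma)$ sends $k_1+\cdots+k_{i-1}+a$ ($1\le a\le k_i$) to $(\sum_{\sigma(i')<\sigma(i)}k_{i'})+a$; permutations compose as functions. $\underline P(X)=\coprod_nP(n)\otimes_{\Sigma_n}X^n$, where $\Sigma_n$ acts on $X^n$ by $\sigma\cdot(x_1,\dots,x_n)=(x_{\sigma^{-1}(1)},\dots,x_{\sigma^{-1}(n)})$ and $P(n)\otimes_{\Sigma_n}X^n$ is the coequalizer in $\mathbf{Cat}$ of $(p,\sigma,\underline x)\mapsto(p\cdot\sigma,\underline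 x)$ and $(p,\sigma,\underline x)\mapsto(p,\sigma\cdot\underline x)$. The unit is $x\mapsto[\mathrm{id};x]$ and the multiplication is $[p;[q_1;\underline{x_1}],\dots,[q_n;\underline{x_n}]]\mapsto[\mu(p;q_1,\dots,q_n);\underline{x_1},\dots,\underline{x_n}]$. An action of a group $G$ on a category $C$ is free if $g\cdot x=x$ for some object or morphism $x$ of $C$ implies that $g$ is the identity of $G$. A 2-monad $T$ on a 2-category with 2-pullbacks is 2-cartesian if $T$ preserves 2-pullbacks up to isomorphism and all naturality squares of the unit and multiplication are 2-pullbacks; in $\mathbf{Cat}$, 2-pullbacks coincide with ordinary (strict) pullbacks. *)

theory Defs
  imports "HOL-Library.FuncSet" "HOL-Combinatorics.Combinatorics"
begin

section \<open>Categories, functors, natural transformations\<close>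

text \<open>
  A type \<open>'u\<close> plays the role of the universe of small sets: the objects of \<open>\<^bold>C\<^bold>a\<^bold>t\<close> are the
  categories of type \<open>'u cat\<close>, whose objects and whose arrows form arbitrary subsets of \<open>'u\<close>.
  For infinite \<open>'u\<close> this is closed up to isomorphism under finite limits, coequalizers and
  countable coproducts.
\<close>

record 'a cat =
  Ob :: "'a set"
  Ar :: "'a set"
  Dom :: "'a \<Rightarrow> 'a"
  Cod :: "'a \<Rightarrow> 'a"
  Idt :: "'a \<Rightarrow> 'a"
  Cmp :: "'a \<Rightarrow> 'a \<Rightarrow> 'a"  \<comment> \<open>\<open>Cmp C g f\<close> is \<open>g\<close> after \<open>f\<close>\<close>

locale category =
  fixes C :: "'a cat"
  assumes dom_in: "f \<in> Ar C \<Longrightarrow> Dom C f \<in> Ob C"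
    and cod_in: "f \<in> Ar C \<Longrightarrow> Cod C f \<in> Ob C"
    and idt_in: "x \<in> Ob C \<Longrightarrow> Idt C x \<in> Ar C"
    and dom_idt: "x \<in> Ob C \<Longrightarrow> Dom C (Idt C x) = x"
    and cod_idt: "x \<in> Ob C \<Longrightarrow> Cod C (Idt C x) = x"
    and cmp_in: "\<lbrakk>f \<in> Ar C; g \<in> Ar C; Cod C f = Dom C g\<rbrakk> \<Longrightarrow> Cmp C g f \<in> Ar C"
    and dom_cmp: "\<lbrakk>f \<in> Ar C; g \<in> Ar C; Cod C f = Dom C g\<rbrakk> \<Longrightarrow> Dom C (Cmp C g f) = Dom C f"
    and cod_cmp: "\<lbrakk>f \<in> Ar C; g \<in> Ar C; Cod C f = Dom C g\<rbrakk> \<Longrightarrow> Cod C (Cmp C g f) = Cod C g"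
    and cmp_idt_right: "f \<in> Ar C \<Longrightarrow> Cmp C f (Idt C (Dom C f)) = f"
    and cmp_idt_left: "f \<in> Ar C \<Longrightarrow> Cmp C (Idt C (Cod C f)) f = f"
    and cmp_assoc: "\<lbrakk>f \<in> Ar C; g \<in> Ar C; h \<in> Ar C; Cod C f = Dom C g; Cod C g = Dom C h\<rbrakk>
      \<Longrightarrow> Cmp C h (Cmp C g f) = Cmp C (Cmp C h g) f"

record ('a, 'b) cfunctor =
  Src :: "'a cat"
  Tgt :: "'b cat"
  Fob :: "'a \<Rightarrow> 'b"
  Far :: "'a \<Rightarrow> 'b"

text \<open>
  The maps are extensional (\<open>undefined\<close> off the carriers), so that equality of functors is
  equality in HOL.
\<close>

locale is_functor =
  fixes F :: "('a, 'b) cfunctor"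
  assumes src_cat: "category (Src F)"
    and tgt_cat: "category (Tgt F)"
    and fob: "Fob F \<in> Ob (Src F) \<rightarrow>\<^sub>E Ob (Tgt F)"
    and far: "Far F \<in> Ar (Src F) \<rightarrow>\<^sub>E Ar (Tgt F)"
    and far_dom: "f \<in> Ar (Src F) \<Longrightarrow> Dom (Tgt F) (Far F f) = Fob F (Dom (Src F) f)"
    and far_cod: "f \<in> Ar (Src F) \<Longrightarrow> Cod (Tgt F) (Far F f) = Fob F (Cod (Src F) f)"
    and far_idt: "x \<in> Ob (Src F) \<Longrightarrow> Far F (Idt (Src F) x) = Idt (Tgt F) (Fob F x)"
    and far_cmp: "\<lbrakk>f \<in> Ar (Src F); g \<in> Ar (Src F); Cod (Src F) f = Dom (Src F) g\<rbrakk>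
      \<Longrightarrow> Far F (Cmp (Src F) g f) = Cmp (Tgt F) (Far F g) (Far F f)"

definition Fun :: "'a cat \<Rightarrow> 'b cat \<Rightarrow> ('a, 'b) cfunctor set" where
  "Fun C D = {F. is_functor F \<and> Src F = C \<and> Tgt F = D}"

definition mk_functor ::
  "'a cat \<Rightarrow> 'b cat \<Rightarrow> ('a \<Rightarrow> 'b) \<Rightarrow> ('a \<Rightarrow> 'b) \<Rightarrow> ('a, 'b) cfunctor" where
  "mk_functor C D fo fa =
     \<lparr>Src = C, Tgt = D, Fob = restrict fo (Ob C), Far = restrict fa (Ar C)\<rparr>"

definition fcomp :: "('b, 'c) cfunctor \<Rightarrow> ('a, 'b) cfunctor \<Rightarrow> ('a, 'c) cfunctor" where
  "fcomp G F = mk_functor (Src F) (Tgt G) (Fob G \<circ> Fob F) (Far G \<circ> Far F)"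

record ('a, 'b) ntrans =
  NSrc :: "('a, 'b) cfunctor"
  NTgt :: "('a, 'b) cfunctor"
  At :: "'a \<Rightarrow> 'b"

definition Nat :: "('a, 'b) cfunctor \<Rightarrow> ('a, 'b) cfunctor \<Rightarrow> ('a, 'b) ntrans set" where
  "Nat F G = {\<alpha>. NSrc \<alpha> = F \<and> NTgt \<alpha> = G \<and>
     is_functor F \<and> is_functor G \<and> Src F = Src G \<and> Tgt F = Tgt G \<and>
     At \<alpha> \<in> Ob (Src F) \<rightarrow>\<^sub>E Ar (Tgt F) \<and>
     (\<forall>x\<in>Ob (Src F). Dom (Tgt F) (At \<alpha> x) = Fob F x \<and> Cod (Tgt F) (At \<alpha> x) = Fob G x) \<and>
     (\<forall>f\<in>Ar (Src F).
        Cmp (Tgt F) (At \<alpha> (Cod (Src F) f)) (Far F f) = Cmp (Tgt F) (Far G f) (At \<alpha> (Dom (Src F) f)))}"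

definition whisker :: "('b, 'c) cfunctor \<Rightarrow> ('a, 'b) ntrans \<Rightarrow> ('a, 'c) ntrans" where
  "whisker H \<alpha> = \<lparr>NSrc = fcomp H (NSrc \<alpha>), NTgt = fcomp H (NTgt \<alpha>),
     At = restrict (Far H \<circ> At \<alpha>) (Ob (Src (NSrc \<alpha>)))\<rparr>"


section \<open>Limits and colimits in \<open>\<^bold>C\<^bold>a\<^bold>t\<close>\<close>

definition bprod :: "'a cat \<Rightarrow> 'b cat \<Rightarrow> ('a \<times> 'b) cat" where
  "bprod C D = \<lparr>Ob = Ob C \<times> Ob D, Ar = Ar C \<times> Ar D,
     Dom = map_prod (Dom C) (Dom D), Cod = map_prod (Cod C) (Cod D),
     Idt = map_prod (Idt C) (Idt D),
     Cmp = (\<lambda>g f. (Cmp C (fst g) (fst f), Cmp D (snd g) (snd f)))\<rparr>"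

definition lprod :: "'a cat list \<Rightarrow> 'a list cat" where
  "lprod Cs = \<lparr>Ob = {xs. list_all2 (\<lambda>x C. x \<in> Ob C) xs Cs},
     Ar = {fs. list_all2 (\<lambda>f C. f \<in> Ar C) fs Cs},
     Dom = (\<lambda>fs. map2 Dom Cs fs), Cod = (\<lambda>fs. map2 Cod Cs fs),
     Idt = (\<lambda>xs. map2 Idt Cs xs),
     Cmp = (\<lambda>gs fs. map (\<lambda>i. Cmp (Cs ! i) (gs ! i) (fs ! i)) [0..<length Cs])\<rparr>"

abbreviation cpower :: "'a cat \<Rightarrow> nat \<Rightarrow> 'a list cat" where
  "cpower X n \<equiv> lprod (replicate n X)"

definition discrete :: "'a set \<Rightarrow> 'a cat" where
  "discrete S = \<lparr>Ob = S, Ar = S, Dom = id, Cod = id, Idt = id, Cmp = (\<lambda>g f. g)\<rparr>"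

definition is_coequalizer ::
  "('a, 'b) cfunctor \<Rightarrow> ('a, 'b) cfunctor \<Rightarrow> ('b, 'u) cfunctor \<Rightarrow> bool" where
  "is_coequalizer F G q \<longleftrightarrow>
     is_functor F \<and> is_functor G \<and> Src F = Src G \<and> Tgt F = Tgt G \<and>
     is_functor q \<and> Src q = Tgt F \<and> fcomp q F = fcomp q G \<and>
     (\<forall>Z :: 'u cat. \<forall>h \<in> Fun (Tgt F) Z. fcomp h F = fcomp h G \<longrightarrow>
        (\<exists>!k. k \<in> Fun (Tgt q) Z \<and> fcomp k q = h))"

definition is_coproduct ::
  "(nat \<Rightarrow> 'u cat) \<Rightarrow> 'u cat \<Rightarrow> (nat \<Rightarrow> ('u, 'u) cfunctor) \<Rightarrow> bool" where
  "is_coproduct A T \<iota> \<longleftrightarrow>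
     (\<forall>n. \<iota> n \<in> Fun (A n) T) \<and>
     (\<forall>Z :: 'u cat. \<forall>h. (\<forall>n. h n \<in> Fun (A n) Z) \<longrightarrow>
        (\<exists>!k. k \<in> Fun T Z \<and> (\<forall>n. fcomp k (\<iota> n) = h n)))"

text \<open>
  The square \<open>f \<circ> h = g \<circ> k\<close>, with \<open>h\<close> and \<open>k\<close> the projections. The last conjunct is the
  two-dimensional part of the universal property.
\<close>

definition two_pullback ::
  "('u, 'u) cfunctor \<Rightarrow> ('u, 'u) cfunctor \<Rightarrow> ('u, 'u) cfunctor \<Rightarrow> ('u, 'u) cfunctor \<Rightarrow> bool" where
  "two_pullback h k f g \<longleftrightarrow>
     is_functor h \<and> is_functor k \<and> is_functor f \<and> is_functor g \<and>
     Src h = Src k \<and> Tgt h = Src f \<and> Tgt k = Src g \<and> Tgt f = Tgt g \<and>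
     fcomp f h = fcomp g k \<and>
     (\<forall>Z :: 'u cat. \<forall>a \<in> Fun Z (Src f). \<forall>b \<in> Fun Z (Src g). fcomp f a = fcomp g b \<longrightarrow>
        (\<exists>!u. u \<in> Fun Z (Src h) \<and> fcomp h u = a \<and> fcomp k u = b)) \<and>
     (\<forall>Z :: 'u cat. \<forall>u \<in> Fun Z (Src h). \<forall>v \<in> Fun Z (Src h).
        \<forall>\<alpha> \<in> Nat (fcomp h u) (fcomp h v). \<forall>\<beta> \<in> Nat (fcomp k u) (fcomp k v).
          whisker f \<alpha> = whisker g \<beta> \<longrightarrow>
          (\<exists>!\<gamma>. \<gamma> \<in> Nat u v \<and> whisker h \<gamma> = \<alpha> \<and> whisker k \<gamma> = \<beta>))"


section \<open>Symmetric operads in \<open>\<^bold>C\<^bold>a\<^bold>t\<close>\<close>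

text \<open>
  Positions are numbered from \<open>0\<close>, so \<open>\<Sigma>\<^sub>n\<close> consists of the \<open>\<sigma>\<close> with \<open>\<sigma> permutes {..<n}\<close>.
  In a list of consecutive blocks of lengths \<open>ks\<close>, position \<open>x\<close> is in block \<open>block_index ks x\<close> at
  offset \<open>block_offset ks x\<close>.
\<close>

abbreviation Sym :: "nat \<Rightarrow> (nat \<Rightarrow> nat) set" where
  "Sym n \<equiv> {\<sigma>. \<sigma> permutes {..<n}}"

definition block_index :: "nat list \<Rightarrow> nat \<Rightarrow> nat" where
  "block_index ks x = (LEAST i. x < sum_list (take (Suc i) ks))"

definition block_offset :: "nat list \<Rightarrow> nat \<Rightarrow> nat" where
  "block_offset ks x = x - sum_list (take (block_index ks x) ks)"

definition block_sum :: "nat list \<Rightarrow> (nat \<Rightarrow> nat \<Rightarrow> nat) \<Rightarrow> nat \<Rightarrow> nat" where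
  "block_sum ks \<tau> x = (if x < sum_list ks
     then sum_list (take (block_index ks x) ks) + \<tau> (block_index ks x) (block_offset ks x) else x)"

definition block_perm :: "nat list \<Rightarrow> (nat \<Rightarrow> nat) \<Rightarrow> nat \<Rightarrow> nat" where
  "block_perm ks \<sigma> x = (if x < sum_list ks
     then (\<Sum>j | j < length ks \<and> \<sigma> j < \<sigma> (block_index ks x). ks ! j) + block_offset ks x else x)"

lemma block_index_offset:
  assumes "i < length ks" "a < ks ! i"
  shows "block_index ks (sum_list (take i ks) + a) = i"
    and "block_offset ks (sum_list (take i ks) + a) = a"
    and "sum_list (take i ks) + a < sum_list ks"
proof -
  have mono: "sum_list (take m ks) \<le> sum_list (take n ks)" if "m \<le> n" for m n
  proof -
    have "take n ks = take m ks @ take (n - m) (drop m ks)"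
      using that by (metis le_add_diff_inverse take_add)
    then show ?thesis by simp
  qed
  have s: "sum_list (take (Suc i) ks) = sum_list (take i ks) + ks ! i"
    using assms(1) by (simp add: take_Suc_conv_app_nth)
  show 1: "block_index ks (sum_list (take i ks) + a) = i"
    unfolding block_index_def
  proof (rule Least_equality)
    show "sum_list (take i ks) + a < sum_list (take (Suc i) ks)"
      using s assms(2) by simp
    show "i \<le> j" if "sum_list (take i ks) + a < sum_list (take (Suc j) ks)" for j
      using mono[of "Suc j" i] that by (cases "i \<le> j") auto
  qed
  show "block_offset ks (sum_list (take i ks) + a) = a"
    by (simp add: block_offset_def 1)
  show "sum_list (take i ks) + a < sum_list ks"
    using s assms(2) mono[of "Suc i" "max (Suc i) (length ks)"] by simp
qed

lemma block_sum_eq: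
  "\<lbrakk>i < length ks; a < ks ! i\<rbrakk> \<Longrightarrow>
     block_sum ks \<tau> (sum_list (take i ks) + a) = sum_list (take i ks) + \<tau> i a"
  by (simp add: block_sum_def block_index_offset)

lemma block_perm_eq:
  "\<lbrakk>i < length ks; a < ks ! i\<rbrakk> \<Longrightarrow>
     block_perm ks \<sigma> (sum_list (take i ks) + a) = (\<Sum>j | j < length ks \<and> \<sigma> j < \<sigma> i. ks ! j) + a"
  by (simp add: block_perm_def block_index_offset)

text \<open>
  The equational laws of a symmetric operad, for sets \<open>E n\<close>, right actions \<open>a n \<sigma> p = p \<cdot> \<sigma>\<close>
  and \<open>m [k\<^sub>1, \<dots>, k\<^sub>n] (p, [q\<^sub>1, \<dots>, q\<^sub>n]) = \<mu>(p; q\<^sub>1, \<dots>, q\<^sub>n)\<close>; the arities \<open>k\<^sub>i\<close> are passed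
  explicitly because the sets \<open>E n\<close> need not be disjoint. An operad in \<open>\<^bold>C\<^bold>a\<^bold>t\<close> has to satisfy
  them on objects and on arrows. In \<open>assoc\<close>, \<open>lss ! i ! j\<close> is the arity of \<open>rss ! i ! j\<close>.
\<close>

locale operad_laws =
  fixes E :: "nat \<Rightarrow> 'u set"
    and a :: "nat \<Rightarrow> (nat \<Rightarrow> nat) \<Rightarrow> 'u \<Rightarrow> 'u"
    and m :: "nat list \<Rightarrow> 'u \<times> 'u list \<Rightarrow> 'u"
    and e :: 'u
  assumes act_id: "p \<in> E n \<Longrightarrow> a n id p = p"
    and act_comp: "\<lbrakk>p \<in> E n; \<sigma> \<in> Sym n; \<tau> \<in> Sym n\<rbrakk> \<Longrightarrow> a n (\<sigma> \<circ> \<tau>) p = a n \<tau> (a n \<sigma> p)"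
    and unit_left: "p \<in> E n \<Longrightarrow> m [n] (e, [p]) = p"
    and unit_right: "p \<in> E n \<Longrightarrow> m (replicate n 1) (p, replicate n e) = p"
    and assoc: "\<lbrakk>p \<in> E (length lss);
        list_all2 (\<lambda>q ls. q \<in> E (length ls)) qs lss;
        list_all2 (list_all2 (\<lambda>r l. r \<in> E l)) rss lss\<rbrakk>
      \<Longrightarrow> m (concat lss) (m (map length lss) (p, qs), concat rss) =
          m (map sum_list lss)
            (p, map (\<lambda>i. m (lss ! i) (qs ! i, rss ! i)) [0..<length lss])"
    and equivariance_block_sum: "\<lbrakk>p \<in> E (length ks); list_all2 (\<lambda>q k. q \<in> E k) qs ks;
        \<And>i. i < length ks \<Longrightarrow> \<tau>s i \<in> Sym (ks ! i)\<rbrakk>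
      \<Longrightarrow> m ks (p, map (\<lambda>i. a (ks ! i) (\<tau>s i) (qs ! i)) [0..<length ks]) =
          a (sum_list ks) (block_sum ks \<tau>s) (m ks (p, qs))"
    and equivariance_block_perm: "\<lbrakk>p \<in> E (length ks); list_all2 (\<lambda>q k. q \<in> E k) qs ks;
        \<sigma> \<in> Sym (length ks)\<rbrakk>
      \<Longrightarrow> m ks (a (length ks) \<sigma> p, qs) =
          a (sum_list ks) (block_perm ks \<sigma>)
            (m (permute_list (inv \<sigma>) ks) (p, permute_list (inv \<sigma>) qs))"

record 'u operad =
  PC :: "nat \<Rightarrow> 'u cat"
  act :: "nat \<Rightarrow> (nat \<Rightarrow> nat) \<Rightarrow> ('u, 'u) cfunctor"
  opid :: 'u
  opmu :: "nat list \<Rightarrow> ('u \<times> 'u list, 'u) cfunctor"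

locale symmetric_operad =
  fixes P :: "'u operad"
  assumes PC_cat: "category (PC P n)"
    and act_fun: "\<sigma> \<in> Sym n \<Longrightarrow> act P n \<sigma> \<in> Fun (PC P n) (PC P n)"
    and opid_in: "opid P \<in> Ob (PC P 1)"
    and opmu_fun: "opmu P ks \<in>
      Fun (bprod (PC P (length ks)) (lprod (map (PC P) ks))) (PC P (sum_list ks))"
    and laws_ob: "operad_laws (\<lambda>n. Ob (PC P n)) (\<lambda>n \<sigma>. Fob (act P n \<sigma>))
      (\<lambda>ks. Fob (opmu P ks)) (opid P)"
    and laws_ar: "operad_laws (\<lambda>n. Ar (PC P n)) (\<lambda>n \<sigma>. Far (act P n \<sigma>))
      (\<lambda>ks. Far (opmu P ks)) (Idt (PC P 1) (opid P))"

definition free_action :: "'g set \<Rightarrow> 'g \<Rightarrow> ('g \<Rightarrow> ('a, 'a) cfunctor) \<Rightarrow> 'a cat \<Rightarrow> bool" where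
  "free_action G e ac C \<longleftrightarrow> (\<forall>g\<in>G.
     (\<exists>x\<in>Ob C. Fob (ac g) x = x) \<or> (\<exists>f\<in>Ar C. Far (ac g) f = f) \<longrightarrow> g = e)"


section \<open>The 2-monad associated to a symmetric operad\<close>

record 'u two_monad =
  T0 :: "'u cat \<Rightarrow> 'u cat"
  T1 :: "('u, 'u) cfunctor \<Rightarrow> ('u, 'u) cfunctor"
  T2 :: "('u, 'u) ntrans \<Rightarrow> ('u, 'u) ntrans"
  eta :: "'u cat \<Rightarrow> ('u, 'u) cfunctor"
  mult :: "'u cat \<Rightarrow> ('u, 'u) cfunctor"

text \<open>
  The two functors \<open>P(n) \<times> \<Sigma>\<^sub>n \<times> X\<^sup>n \<rightarrow> P(n) \<times> X\<^sup>n\<close> coequalized by \<open>P(n) \<otimes> X\<^sup>n\<close>, with \<open>\<Sigma>\<^sub>n\<close>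
  regarded as a discrete category; the left action of \<open>\<sigma>\<close> on a list is
  \<open>permute_list (inv \<sigma>)\<close>.
\<close>

definition act_source ::
  "'u operad \<Rightarrow> nat \<Rightarrow> 'u cat \<Rightarrow> ('u \<times> (nat \<Rightarrow> nat) \<times> 'u list) cat" where
  "act_source P n X = bprod (PC P n) (bprod (discrete (Sym n)) (cpower X n))"

definition act_left ::
  "'u operad \<Rightarrow> nat \<Rightarrow> 'u cat \<Rightarrow> ('u \<times> (nat \<Rightarrow> nat) \<times> 'u list, 'u \<times> 'u list) cfunctor" where
  "act_left P n X = mk_functor (act_source P n X) (bprod (PC P n) (cpower X n))
     (\<lambda>(p, \<sigma>, xs). (Fob (act P n \<sigma>) p, xs))
     (\<lambda>(p, \<sigma>, xs). (Far (act P n \<sigma>) p, xs))"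

definition act_right ::
  "'u operad \<Rightarrow> nat \<Rightarrow> 'u cat \<Rightarrow> ('u \<times> (nat \<Rightarrow> nat) \<times> 'u list, 'u \<times> 'u list) cfunctor" where
  "act_right P n X = mk_functor (act_source P n X) (bprod (PC P n) (cpower X n))
     (\<lambda>(p, \<sigma>, xs). (p, permute_list (inv \<sigma>) xs))
     (\<lambda>(p, \<sigma>, xs). (p, permute_list (inv \<sigma>) xs))"

text \<open>
  Coequalizers and coproducts are determined up to isomorphism only. A choice of them consists of
  the coequalizers \<open>q n X : P(n) \<times> X\<^sup>n \<rightarrow> P(n) \<otimes> X\<^sup>n\<close> and the coprojections
  \<open>\<iota> n X : P(n) \<otimes> X\<^sup>n \<rightarrow> T X\<close>. The following are the maps \<open>(p, xs) \<mapsto> [p; xs]\<close> on objects and on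
  arrows.
\<close>

definition brO ::
  "(nat \<Rightarrow> 'u cat \<Rightarrow> ('u \<times> 'u list, 'u) cfunctor) \<Rightarrow> (nat \<Rightarrow> 'u cat \<Rightarrow> ('u, 'u) cfunctor) \<Rightarrow>
   nat \<Rightarrow> 'u cat \<Rightarrow> 'u \<Rightarrow> 'u list \<Rightarrow> 'u" where
  "brO q \<iota> n X p xs = Fob (\<iota> n X) (Fob (q n X) (p, xs))"

definition brA ::
  "(nat \<Rightarrow> 'u cat \<Rightarrow> ('u \<times> 'u list, 'u) cfunctor) \<Rightarrow> (nat \<Rightarrow> 'u cat \<Rightarrow> ('u, 'u) cfunctor) \<Rightarrow>
   nat \<Rightarrow> 'u cat \<Rightarrow> 'u \<Rightarrow> 'u list \<Rightarrow> 'u" where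
  "brA q \<iota> n X f fs = Far (\<iota> n X) (Far (q n X) (f, fs))"

text \<open>
  \<open>M\<close> is the 2-monad \<open>P\<close> gives rise to, for the choice \<open>q\<close>, \<open>\<iota>\<close>. Every object and every arrow of
  \<open>T X\<close> has the form \<open>[p; xs]\<close>, so the equations determine all the data, and the laws of a 2-monad
  follow from them.
\<close>

locale operad_two_monad =
  fixes P :: "'u operad"
    and q :: "nat \<Rightarrow> 'u cat \<Rightarrow> ('u \<times> 'u list, 'u) cfunctor"
    and \<iota> :: "nat \<Rightarrow> 'u cat \<Rightarrow> ('u, 'u) cfunctor"
    and M :: "'u two_monad"
  assumes coeq: "category X \<Longrightarrow> is_coequalizer (act_left P n X) (act_right P n X) (q n X)"
    and coprod: "category X \<Longrightarrow> is_coproduct (\<lambda>n. Tgt (q n X)) (T0 M X) (\<lambda>n. \<iota> n X)"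
    and T1_fun: "F \<in> Fun X Y \<Longrightarrow> T1 M F \<in> Fun (T0 M X) (T0 M Y)"
    and T1_ob: "\<lbrakk>F \<in> Fun X Y; (p, xs) \<in> Ob (bprod (PC P n) (cpower X n))\<rbrakk> \<Longrightarrow>
      Fob (T1 M F) (brO q \<iota> n X p xs) = brO q \<iota> n Y p (map (Fob F) xs)"
    and T1_ar: "\<lbrakk>F \<in> Fun X Y; (f, fs) \<in> Ar (bprod (PC P n) (cpower X n))\<rbrakk> \<Longrightarrow>
      Far (T1 M F) (brA q \<iota> n X f fs) = brA q \<iota> n Y f (map (Far F) fs)"
    and T2_nat: "\<alpha> \<in> Nat F G \<Longrightarrow> T2 M \<alpha> \<in> Nat (T1 M F) (T1 M G)"
    and T2_at: "\<lbrakk>F \<in> Fun X Y; \<alpha> \<in> Nat F G; (p, xs) \<in> Ob (bprod (PC P n) (cpower X n))\<rbrakk> \<Longrightarrow>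
      At (T2 M \<alpha>) (brO q \<iota> n X p xs) = brA q \<iota> n Y (Idt (PC P n) p) (map (At \<alpha>) xs)"
    and eta_fun: "category X \<Longrightarrow> eta M X \<in> Fun X (T0 M X)"
    and eta_ob: "\<lbrakk>category X; x \<in> Ob X\<rbrakk> \<Longrightarrow> Fob (eta M X) x = brO q \<iota> 1 X (opid P) [x]"
    and eta_ar: "\<lbrakk>category X; f \<in> Ar X\<rbrakk> \<Longrightarrow>
      Far (eta M X) f = brA q \<iota> 1 X (Idt (PC P 1) (opid P)) [f]"
    and mult_fun: "category X \<Longrightarrow> mult M X \<in> Fun (T0 M (T0 M X)) (T0 M X)"
    and mult_ob: "\<lbrakk>category X; (p, ps) \<in> Ob (bprod (PC P (length ks)) (lprod (map (PC P) ks)));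
        list_all2 (\<lambda>xs k. xs \<in> Ob (cpower X k)) xss ks\<rbrakk> \<Longrightarrow>
      Fob (mult M X) (brO q \<iota> (length ks) (T0 M X) p
          (map (\<lambda>i. brO q \<iota> (ks ! i) X (ps ! i) (xss ! i)) [0..<length ks])) =
        brO q \<iota> (sum_list ks) X (Fob (opmu P ks) (p, ps)) (concat xss)"
    and mult_ar: "\<lbrakk>category X; (f, fs) \<in> Ar (bprod (PC P (length ks)) (lprod (map (PC P) ks)));
        list_all2 (\<lambda>gs k. gs \<in> Ar (cpower X k)) gss ks\<rbrakk> \<Longrightarrow>
      Far (mult M X) (brA q \<iota> (length ks) (T0 M X) f
          (map (\<lambda>i. brA q \<iota> (ks ! i) X (fs ! i) (gss ! i)) [0..<length ks])) =
        brA q \<iota> (sum_list ks) X (Far (opmu P ks) (f, fs)) (concat gss)"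

definition two_cartesian :: "'u two_monad \<Rightarrow> bool" where
  "two_cartesian M \<longleftrightarrow>
     (\<forall>h k f g. two_pullback h k f g \<longrightarrow>
        two_pullback (T1 M h) (T1 M k) (T1 M f) (T1 M g)) \<and>
     (\<forall>X Y. \<forall>F \<in> Fun X Y. two_pullback F (eta M X) (eta M Y) (T1 M F)) \<and>
     (\<forall>X Y. \<forall>F \<in> Fun X Y. two_pullback (T1 M (T1 M F)) (mult M X) (mult M Y) (T1 M F))"

end

theory Submission
  imports Defs
begin

text \<open>
  A square in \<open>\<^bold>C\<^bold>a\<^bold>t\<close> is a 2-pullback as soon as it is a pullback of sets on arrows. If the actions are
  free, then the arrows of \<open>T X\<close> are the orbits of pairs \<open>(f, fs)\<close>, and two classes \<open>[f; fs]\<close>, \<open>[f; gs]\<close>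
  with the same first component agree only for \<open>fs = gs\<close>. A class mapped to \<open>[f; gs]\<close> by \<open>T F\<close> can be
  written \<open>[f; fs]\<close> with \<open>F fs = gs\<close>, so each of the required pullbacks reduces to one between tuples.
  Conversely, an object \<open>p = p \<cdot> \<sigma>\<close> with \<open>\<sigma> \<noteq> id\<close> prevents \<open>T\<close> from preserving the product of a discrete
  category with itself. A fixed arrow has a fixed domain.
\<close>

section \<open>Functors\<close>

lemma FunD:
  assumes "F \<in> Fun C D"
  shows "is_functor F" "Src F = C" "Tgt F = D" "category C" "category D"
    "Fob F \<in> Ob C \<rightarrow>\<^sub>E Ob D" "Far F \<in> Ar C \<rightarrow>\<^sub>E Ar D"
    "x \<in> Ob C \<Longrightarrow> Fob F x \<in> Ob D"
    "f \<in> Ar C \<Longrightarrow> Far F f \<in> Ar D"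
    "f \<in> Ar C \<Longrightarrow> Dom D (Far F f) = Fob F (Dom C f)"
    "f \<in> Ar C \<Longrightarrow> Cod D (Far F f) = Fob F (Cod C f)"
    "x \<in> Ob C \<Longrightarrow> Far F (Idt C x) = Idt D (Fob F x)"
    "\<lbrakk>f \<in> Ar C; g \<in> Ar C; Cod C f = Dom C g\<rbrakk> \<Longrightarrow> Far F (Cmp C g f) = Cmp D (Far F g) (Far F f)"
proof -
  interpret F: is_functor F using assms by (simp add: Fun_def)
  have *: "Src F = C" "Tgt F = D" using assms by (auto simp: Fun_def)
  show "is_functor F" "Src F = C" "Tgt F = D" "category C" "category D"
    "Fob F \<in> Ob C \<rightarrow>\<^sub>E Ob D" "Far F \<in> Ar C \<rightarrow>\<^sub>E Ar D"
    using F.is_functor_axioms F.src_cat F.tgt_cat F.fob F.far * by auto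
  show "x \<in> Ob C \<Longrightarrow> Fob F x \<in> Ob D" "f \<in> Ar C \<Longrightarrow> Far F f \<in> Ar D"
    using F.fob F.far * by auto
  show "f \<in> Ar C \<Longrightarrow> Dom D (Far F f) = Fob F (Dom C f)"
    "f \<in> Ar C \<Longrightarrow> Cod D (Far F f) = Fob F (Cod C f)"
    "x \<in> Ob C \<Longrightarrow> Far F (Idt C x) = Idt D (Fob F x)"
    "\<lbrakk>f \<in> Ar C; g \<in> Ar C; Cod C f = Dom C g\<rbrakk> \<Longrightarrow> Far F (Cmp C g f) = Cmp D (Far F g) (Far F f)"
    using F.far_dom F.far_cod F.far_idt F.far_cmp * by auto
qed

lemma functor_eqI:
  assumes "F \<in> Fun C D" "G \<in> Fun C D"
    and "\<And>x. x \<in> Ob C \<Longrightarrow> Fob F x = Fob G x"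
    and "\<And>f. f \<in> Ar C \<Longrightarrow> Far F f = Far G f"
  shows "F = G"
proof -
  have "Fob F = Fob G" using FunD(6)[OF assms(1)] FunD(6)[OF assms(2)] assms(3) by (rule PiE_ext)
  moreover have "Far F = Far G" using FunD(7)[OF assms(1)] FunD(7)[OF assms(2)] assms(4) by (rule PiE_ext)
  ultimately show ?thesis using FunD(2,3)[OF assms(1)] FunD(2,3)[OF assms(2)]
    by (intro cfunctor.equality) auto
qed

lemma mk_functor_simps [simp]:
  "Src (mk_functor C D fo fa) = C" "Tgt (mk_functor C D fo fa) = D"
  "x \<in> Ob C \<Longrightarrow> Fob (mk_functor C D fo fa) x = fo x"
  "f \<in> Ar C \<Longrightarrow> Far (mk_functor C D fo fa) f = fa f"
  by (auto simp: mk_functor_def)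

lemma mk_functor_Fun:
  assumes C: "category C" and D: "category D"
    and "\<And>x. x \<in> Ob C \<Longrightarrow> fo x \<in> Ob D"
    and "\<And>f. f \<in> Ar C \<Longrightarrow> fa f \<in> Ar D"
    and "\<And>f. f \<in> Ar C \<Longrightarrow> Dom D (fa f) = fo (Dom C f)"
    and "\<And>f. f \<in> Ar C \<Longrightarrow> Cod D (fa f) = fo (Cod C f)"
    and "\<And>x. x \<in> Ob C \<Longrightarrow> fa (Idt C x) = Idt D (fo x)"
    and "\<And>f g. \<lbrakk>f \<in> Ar C; g \<in> Ar C; Cod C f = Dom C g\<rbrakk>
      \<Longrightarrow> fa (Cmp C g f) = Cmp D (fa g) (fa f)"
  shows "mk_functor C D fo fa \<in> Fun C D"
proof -
  interpret C: category C by fact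
  show ?thesis unfolding Fun_def mem_Collect_eq
    apply (intro conjI is_functor.intro)
    using assms by (auto simp: mk_functor_def C.dom_in C.cod_in C.idt_in C.cmp_in)
qed

lemma fcomp_simps [simp]:
  "Src (fcomp G F) = Src F" "Tgt (fcomp G F) = Tgt G"
  "x \<in> Ob (Src F) \<Longrightarrow> Fob (fcomp G F) x = Fob G (Fob F x)"
  "f \<in> Ar (Src F) \<Longrightarrow> Far (fcomp G F) f = Far G (Far F f)"
  by (auto simp: fcomp_def)

lemma fcomp_Fun:
  assumes F: "F \<in> Fun C D" and G: "G \<in> Fun D E"
  shows "fcomp G F \<in> Fun C E"
  unfolding fcomp_def FunD(2)[OF F] FunD(3)[OF G]
  by (rule mk_functor_Fun) (simp_all add: FunD[OF F] FunD[OF G] category.dom_in category.cod_in)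

lemma fcomp_eqD:
  assumes "fcomp G F = H" "F \<in> Fun C D"
  shows "x \<in> Ob C \<Longrightarrow> Fob G (Fob F x) = Fob H x"
    "f \<in> Ar C \<Longrightarrow> Far G (Far F f) = Far H f"
  using assms(1) FunD(2)[OF assms(2)] by auto

lemma fcomp_assoc:
  assumes "F \<in> Fun A B" "G \<in> Fun B C" "H \<in> Fun C D"
  shows "fcomp (fcomp H G) F = fcomp H (fcomp G F)"
  by (rule functor_eqI[of _ A D])
     (simp_all add: fcomp_Fun[OF assms(1)] fcomp_Fun[OF assms(2)] fcomp_Fun assms FunD[OF assms(1)] FunD[OF assms(2)]
       fcomp_Fun[OF fcomp_Fun[OF assms(1,2)] assms(3)]
       fcomp_Fun[OF assms(1) fcomp_Fun[OF assms(2,3)]])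

lemma functor_eq_of_Ar:
  assumes F: "F \<in> Fun C D" and G: "G \<in> Fun C D"
    and "\<And>f. f \<in> Ar C \<Longrightarrow> Far F f = Far G f"
  shows "F = G"
proof (rule functor_eqI[OF F G _ assms(3)])
  interpret C: category C using F by (rule FunD)
  fix x assume "x \<in> Ob C"
  then show "Fob F x = Fob G x"
    using FunD(10)[OF F, of "Idt C x"] FunD(10)[OF G, of "Idt C x"] assms(3)[of "Idt C x"]
    by (simp add: C.idt_in C.dom_idt)
qed

definition id_functor :: "'a cat \<Rightarrow> ('a, 'a) cfunctor" where
  "id_functor C = mk_functor C C id id"

lemma id_functor_Fun: "category C \<Longrightarrow> id_functor C \<in> Fun C C"
  unfolding id_functor_def by (rule mk_functor_Fun) auto

lemma id_functor_simps [simp]: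
  "Src (id_functor C) = C" "Tgt (id_functor C) = C"
  "x \<in> Ob C \<Longrightarrow> Fob (id_functor C) x = x" "f \<in> Ar C \<Longrightarrow> Far (id_functor C) f = f"
  by (auto simp: id_functor_def)

definition const_functor :: "'a cat \<Rightarrow> 'b cat \<Rightarrow> 'b \<Rightarrow> ('a, 'b) cfunctor" where
  "const_functor C D x = mk_functor C D (\<lambda>_. x) (\<lambda>_. Idt D x)"

lemma const_functor_Fun:
  assumes "category C" "category D" "x \<in> Ob D"
  shows "const_functor C D x \<in> Fun C D"
proof -
  interpret D: category D by fact
  show ?thesis unfolding const_functor_def
    using assms D.cmp_idt_left[of "Idt D x"]
    by (intro mk_functor_Fun) (auto simp: D.idt_in D.dom_idt D.cod_idt)
qed

lemma const_functor_simps [simp]: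
  "Src (const_functor C D x) = C" "Tgt (const_functor C D x) = D"
  "y \<in> Ob C \<Longrightarrow> Fob (const_functor C D x) y = x"
  by (auto simp: const_functor_def)

definition subcat :: "'a cat \<Rightarrow> 'a set \<Rightarrow> 'a set \<Rightarrow> 'a cat" where
  "subcat C S A = C\<lparr>Ob := S, Ar := A\<rparr>"

lemma subcat_simps [simp]:
  "Ob (subcat C S A) = S" "Ar (subcat C S A) = A" "Dom (subcat C S A) = Dom C"
  "Cod (subcat C S A) = Cod C" "Idt (subcat C S A) = Idt C" "Cmp (subcat C S A) = Cmp C"
  by (auto simp: subcat_def)

definition corestrict :: "('a, 'b) cfunctor \<Rightarrow> 'b cat \<Rightarrow> ('a, 'b) cfunctor" where
  "corestrict F D = mk_functor (Src F) D (Fob F) (Far F)"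

lemma corestrict_simps [simp]:
  "Src (corestrict F D) = Src F" "Tgt (corestrict F D) = D"
  "x \<in> Ob (Src F) \<Longrightarrow> Fob (corestrict F D) x = Fob F x"
  "f \<in> Ar (Src F) \<Longrightarrow> Far (corestrict F D) f = Far F f"
  by (auto simp: corestrict_def)

locale closed_subcat = category C for C :: "'a cat" +
  fixes S A
  assumes sub: "S \<subseteq> Ob C" "A \<subseteq> Ar C"
    and closed: "f \<in> A \<Longrightarrow> Dom C f \<in> S" "f \<in> A \<Longrightarrow> Cod C f \<in> S" "x \<in> S \<Longrightarrow> Idt C x \<in> A"
      "\<lbrakk>f \<in> A; g \<in> A; Cod C f = Dom C g\<rbrakk> \<Longrightarrow> Cmp C g f \<in> A"
begin

lemma subcat_category: "category (subcat C S A)"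
  by (rule category.intro)
     (use sub closed in \<open>auto simp: dom_idt cod_idt dom_cmp cod_cmp cmp_idt_left cmp_idt_right
        subset_iff intro!: cmp_assoc\<close>)

lemma inclusion_Fun: "corestrict (id_functor (subcat C S A)) C \<in> Fun (subcat C S A) C"
  unfolding corestrict_def id_functor_simps
  by (rule mk_functor_Fun)
     (use subcat_category category_axioms sub closed in \<open>auto simp: subset_iff\<close>)

lemma corestrict_Fun:
  assumes F: "F \<in> Fun B C" and "Fob F ` Ob B \<subseteq> S" "Far F ` Ar B \<subseteq> A"
  shows "corestrict F (subcat C S A) \<in> Fun B (subcat C S A)"
  unfolding corestrict_def FunD(2)[OF F]
  by (rule mk_functor_Fun) (use FunD[OF F] subcat_category assms in auto)

end

section \<open>Test categories\<close>

lemma infinite_bij_Times: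
  assumes "infinite (UNIV :: 'u set)"
  obtains d :: "'u \<Rightarrow> 'u \<times> 'u" where "bij d"
proof -
  obtain e :: "'u \<times> 'u \<Rightarrow> 'u" where "bij e"
    using card_of_Times_same_infinite[OF assms] by (auto simp flip: card_of_ordIso)
  then show thesis using that bij_imp_bij_inv by blast
qed

lemma infinite_list_encoding:
  assumes "infinite (UNIV :: 'u set)"
  shows "\<exists>e :: 'u list \<Rightarrow> 'u. inj_on e {xs. length xs = n}"
proof (induction n)
  case 0
  show ?case by (auto simp: inj_on_def)
next
  case (Suc n)
  then obtain e :: "'u list \<Rightarrow> 'u" where e: "inj_on e {xs. length xs = n}" by blast
  obtain d :: "'u \<Rightarrow> 'u \<times> 'u" where d: "bij d" by (rule infinite_bij_Times[OF assms])
  have "inj_on (\<lambda>xs. inv d (hd xs, e (tl xs))) {xs. length xs = Suc n}"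
  proof (rule inj_onI)
    fix xs ys assume *: "xs \<in> {xs :: 'u list. length xs = Suc n}" "ys \<in> {xs. length xs = Suc n}"
      and "inv d (hd xs, e (tl xs)) = inv d (hd ys, e (tl ys))"
    then have "hd xs = hd ys" "e (tl xs) = e (tl ys)"
      using bij_imp_bij_inv[OF d] by (auto dest!: bij_is_inj injD)
    then have "hd xs = hd ys" "tl xs = tl ys"
      using inj_onD[OF e, of "tl xs" "tl ys"] * by auto
    then show "xs = ys" using * by (cases xs; cases ys) auto
  qed
  then show ?case by blast
qed

lemma indiscrete_category:
  assumes "infinite (UNIV :: 'u set)"
  obtains Z :: "'u cat" where "category Z" "Ob Z = UNIV"
    "\<And>(C :: 'b cat) (fo :: 'b \<Rightarrow> 'u). category C \<Longrightarrow> \<exists>F \<in> Fun C Z. \<forall>x\<in>Ob C. Fob F x = fo x"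
    "\<And>f g. \<lbrakk>Dom Z f = Dom Z g; Cod Z f = Cod Z g\<rbrakk> \<Longrightarrow> f = g"
proof -
  obtain d :: "'u \<Rightarrow> 'u \<times> 'u" where d: "bij d" by (rule infinite_bij_Times[OF assms])
  have [simp]: "d (inv d y) = y" for y using d by (simp add: bij_is_surj surj_f_inv_f)
  have [simp]: "inv d (d y) = y" for y using d by (simp add: bij_is_inj inv_f_f)
  define Z where "Z = \<lparr>Ob = UNIV :: 'u set, Ar = UNIV, Dom = fst \<circ> d, Cod = snd \<circ> d,
    Idt = (\<lambda>x. inv d (x, x)), Cmp = (\<lambda>g f. inv d (fst (d f), snd (d g)))\<rparr>"
  have Z: "category Z" by (rule category.intro) (auto simp: Z_def)
  show thesis
  proof
    show "category Z" by fact
    show "Ob Z = UNIV" by (simp add: Z_def)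
    show "f = g" if "Dom Z f = Dom Z g" "Cod Z f = Cod Z g" for f g
      by (rule injD[OF bij_is_inj[OF d]], rule prod_eqI) (use that in \<open>simp_all add: Z_def\<close>)
  next
    fix C :: "'b cat" and fo :: "'b \<Rightarrow> 'u"
    assume C: "category C"
    interpret C: category C by fact
    have "mk_functor C Z fo (\<lambda>f. inv d (fo (Dom C f), fo (Cod C f))) \<in> Fun C Z"
      by (rule mk_functor_Fun[OF C Z]) (auto simp: Z_def C.dom_idt C.cod_idt C.dom_cmp C.cod_cmp)
    then show "\<exists>F \<in> Fun C Z. \<forall>x\<in>Ob C. Fob F x = fo x"
      by (rule bexI[rotated]) auto
  qed
qed

lemma walking_arrow:
  assumes "infinite (UNIV :: 'u set)"
  obtains Z :: "'u cat" and c where "category Z" "c \<in> Ar Z"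
    "\<And>(D :: 'u cat) m. \<lbrakk>category D; m \<in> Ar D\<rbrakk> \<Longrightarrow> \<exists>F \<in> Fun Z D. Far F c = m"
    "\<And>(D :: 'u cat) F G. \<lbrakk>F \<in> Fun Z D; G \<in> Fun Z D; Far F c = Far G c\<rbrakk> \<Longrightarrow> F = G"
proof -
  obtain S :: "'u set" where "card S = 3" "finite S"
    using infinite_arbitrarily_large[OF assms] by blast
  then obtain a b c :: 'u where [simp]: "a \<noteq> b" "b \<noteq> c" "a \<noteq> c"
    by (auto simp: card_Suc_eq numeral_3_eq_3)
  note [simp] = \<open>a \<noteq> b\<close>[symmetric] \<open>b \<noteq> c\<close>[symmetric] \<open>a \<noteq> c\<close>[symmetric]
  define Z where "Z = \<lparr>Ob = {a, b}, Ar = {a, b, c}, Dom = (\<lambda>x. if x = c then a else x),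
    Cod = (\<lambda>x. if x = c then b else x), Idt = id, Cmp = (\<lambda>g f. if g = c then c else f)\<rparr>"
  have Z: "category Z" by (rule category.intro) (auto simp: Z_def)
  show thesis
  proof
    show "category Z" by fact
    show "c \<in> Ar Z" by (simp add: Z_def)
  next
    fix D :: "'u cat" and m assume D: "category D" and m: "m \<in> Ar D"
    interpret D: category D by fact
    have [simp]: "Cmp D m (Idt D (Dom D m)) = m" "Cmp D (Idt D (Cod D m)) m = m"
      "x \<in> Ob D \<Longrightarrow> Cmp D (Idt D x) (Idt D x) = Idt D x" for x
      using m D.cmp_idt_left[of "Idt D x"]
      by (auto simp: D.cmp_idt_left D.cmp_idt_right D.idt_in D.cod_idt)
    have "mk_functor Z D (\<lambda>x. if x = a then Dom D m else Cod D m)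
      (\<lambda>x. if x = a then Idt D (Dom D m) else if x = b then Idt D (Cod D m) else m) \<in> Fun Z D"
      using m by (intro mk_functor_Fun[OF Z D])
        (auto simp: Z_def D.dom_in D.cod_in D.idt_in D.dom_idt D.cod_idt split: if_splits)
    then show "\<exists>F \<in> Fun Z D. Far F c = m" by (rule bexI[rotated]) (simp add: Z_def)
  next
    fix D :: "'u cat" and F G assume F: "F \<in> Fun Z D" and G: "G \<in> Fun Z D" and *: "Far F c = Far G c"
    have ob: "Fob F x = Fob G x" if "x \<in> Ob Z" for x
      using that FunD(10,11)[OF F, of c] FunD(10,11)[OF G, of c] * by (auto simp: Z_def)
    show "F = G"
    proof (rule functor_eqI[OF F G ob])
      fix f assume "f \<in> Ar Z"
      then have "f = c \<or> f \<in> Ob Z \<and> f = Idt Z f" by (auto simp: Z_def)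
      then show "Far F f = Far G f"
        using * FunD(12)[OF F, of f] FunD(12)[OF G, of f] ob[of f] by auto
    qed
  qed
qed

section \<open>Pullbacks\<close>

definition pullback_on ::
  "'w set \<Rightarrow> 'a set \<Rightarrow> 'b set \<Rightarrow> ('w \<Rightarrow> 'a) \<Rightarrow> ('w \<Rightarrow> 'b) \<Rightarrow> ('a \<Rightarrow> 'd) \<Rightarrow> ('b \<Rightarrow> 'd) \<Rightarrow> bool" where
  "pullback_on W A B h k f g \<longleftrightarrow>
     (\<forall>x\<in>A. \<forall>y\<in>B. f x = g y \<longrightarrow> (\<exists>!w. w \<in> W \<and> h w = x \<and> k w = y))"

lemma pullback_onI:
  assumes "\<And>x y. \<lbrakk>x \<in> A; y \<in> B; f x = g y\<rbrakk> \<Longrightarrow> \<exists>w\<in>W. h w = x \<and> k w = y"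
    and "\<And>w w'. \<lbrakk>w \<in> W; w' \<in> W; h w = h w'; k w = k w'\<rbrakk> \<Longrightarrow> w = w'"
  shows "pullback_on W A B h k f g"
  unfolding pullback_on_def using assms by metis

locale arrow_pullback =
  fixes W A B D :: "'u cat" and h k f g
  assumes h: "h \<in> Fun W A" and k: "k \<in> Fun W B" and f: "f \<in> Fun A D" and g: "g \<in> Fun B D"
    and commute: "fcomp f h = fcomp g k"
    and arrows: "pullback_on (Ar W) (Ar A) (Ar B) (Far h) (Far k) (Far f) (Far g)"
begin

sublocale W: category W using h by (rule FunD)
sublocale A: category A using f by (rule FunD)
sublocale B: category B using g by (rule FunD)
sublocale D: category D using g by (rule FunD)

lemma commute_ar: "m \<in> Ar W \<Longrightarrow> Far f (Far h m) = Far g (Far k m)"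
  using fcomp_eqD[OF commute h] FunD(2)[OF k] by auto

lemma ar_unique:
  assumes "m \<in> Ar W" "m' \<in> Ar W" "Far h m = Far h m'" "Far k m = Far k m'"
  shows "m = m'"
proof -
  have "Far h m \<in> Ar A" "Far k m \<in> Ar B" using assms FunD[OF h] FunD[OF k] by auto
  then have "\<exists>!w. w \<in> Ar W \<and> Far h w = Far h m \<and> Far k w = Far k m"
    using arrows commute_ar[OF assms(1)] unfolding pullback_on_def by blast
  then show ?thesis using assms by (auto simp: Ex1_def)
qed

lemma ob_unique:
  assumes "x \<in> Ob W" "x' \<in> Ob W" "Fob h x = Fob h x'" "Fob k x = Fob k x'"
  shows "x = x'"
proof -
  have "Idt W x = Idt W x'"
    by (rule ar_unique) (use assms FunD[OF h] FunD[OF k] in \<open>auto simp: W.idt_in\<close>)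
  then show ?thesis using W.dom_idt assms by metis
qed

definition pair_ar where "pair_ar x y = (THE w. w \<in> Ar W \<and> Far h w = x \<and> Far k w = y)"

lemma pair_ar:
  assumes "x \<in> Ar A" "y \<in> Ar B" "Far f x = Far g y"
  shows "pair_ar x y \<in> Ar W" "Far h (pair_ar x y) = x" "Far k (pair_ar x y) = y"
proof -
  have "\<exists>!w. w \<in> Ar W \<and> Far h w = x \<and> Far k w = y"
    using arrows assms unfolding pullback_on_def by blast
  from theI'[OF this] show "pair_ar x y \<in> Ar W" "Far h (pair_ar x y) = x" "Far k (pair_ar x y) = y"
    by (auto simp: pair_ar_def)
qed

definition pair_ob where "pair_ob x y = Dom W (pair_ar (Idt A x) (Idt B y))"

lemma pair_ob:
  assumes "x \<in> Ob A" "y \<in> Ob B" "Fob f x = Fob g y"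
  shows "pair_ob x y \<in> Ob W" "Fob h (pair_ob x y) = x" "Fob k (pair_ob x y) = y"
proof -
  have "Idt A x \<in> Ar A" "Idt B y \<in> Ar B" "Far f (Idt A x) = Far g (Idt B y)"
    using assms FunD[OF f] FunD[OF g] by (auto simp: A.idt_in B.idt_in)
  note * = pair_ar[OF this]
  show "pair_ob x y \<in> Ob W" using * by (simp add: pair_ob_def W.dom_in)
  show "Fob h (pair_ob x y) = x" "Fob k (pair_ob x y) = y"
    using FunD(10)[OF h *(1)] FunD(10)[OF k *(1)] * assms
    by (auto simp: pair_ob_def A.dom_idt B.dom_idt)
qed

lemma pairing_functor:
  assumes a: "a \<in> Fun Z A" and b: "b \<in> Fun Z B" and ab: "fcomp f a = fcomp g b"
  shows "\<exists>u \<in> Fun Z W. fcomp h u = a \<and> fcomp k u = b"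
proof -
  interpret Z: category Z using a by (rule FunD)
  note aD = FunD(8-13)[OF a] and bD = FunD(8-13)[OF b] and hD = FunD(8-13)[OF h] and kD = FunD(8-13)[OF k]
  have ob: "Fob f (Fob a z) = Fob g (Fob b z)" if "z \<in> Ob Z" for z
    using fcomp_eqD(1)[OF ab a that] FunD(2)[OF b] that by simp
  have ar: "Far f (Far a z) = Far g (Far b z)" if "z \<in> Ar Z" for z
    using fcomp_eqD(2)[OF ab a that] FunD(2)[OF b] that by simp
  have ob': "pair_ob (Fob a z) (Fob b z) \<in> Ob W" "Fob h (pair_ob (Fob a z) (Fob b z)) = Fob a z"
    "Fob k (pair_ob (Fob a z) (Fob b z)) = Fob b z" if "z \<in> Ob Z" for z
    using pair_ob[OF _ _ ob[OF that]] aD(1) bD(1) that by auto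
  have ar': "pair_ar (Far a z) (Far b z) \<in> Ar W" "Far h (pair_ar (Far a z) (Far b z)) = Far a z"
    "Far k (pair_ar (Far a z) (Far b z)) = Far b z" if "z \<in> Ar Z" for z
    using pair_ar[OF _ _ ar[OF that]] aD(2) bD(2) that by auto
  define u where "u = mk_functor Z W (\<lambda>z. pair_ob (Fob a z) (Fob b z)) (\<lambda>z. pair_ar (Far a z) (Far b z))"
  have u: "u \<in> Fun Z W" unfolding u_def
  proof (rule mk_functor_Fun)
    show "category Z" "category W" by unfold_locales
    fix m assume m: "m \<in> Ar Z"
    show "Dom W (pair_ar (Far a m) (Far b m)) = pair_ob (Fob a (Dom Z m)) (Fob b (Dom Z m))"
      by (rule ob_unique)
         (use m ar' ob' hD(3)[OF ar'(1)[OF m], symmetric] kD(3)[OF ar'(1)[OF m], symmetric] aD bD in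
           \<open>auto simp: W.dom_in Z.dom_in\<close>)
    show "Cod W (pair_ar (Far a m) (Far b m)) = pair_ob (Fob a (Cod Z m)) (Fob b (Cod Z m))"
      by (rule ob_unique)
         (use m ar' ob' hD(4)[OF ar'(1)[OF m], symmetric] kD(4)[OF ar'(1)[OF m], symmetric] aD bD in
           \<open>auto simp: W.cod_in Z.cod_in\<close>)
  next
    fix x assume x: "x \<in> Ob Z"
    show "pair_ar (Far a (Idt Z x)) (Far b (Idt Z x)) = Idt W (pair_ob (Fob a x) (Fob b x))"
      by (rule ar_unique)
         (use ar'[OF Z.idt_in[OF x]] ob'[OF x] aD(5)[OF x] bD(5)[OF x]
            hD(5)[OF ob'(1)[OF x]] kD(5)[OF ob'(1)[OF x]] in \<open>simp_all add: W.idt_in\<close>)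
  next
    fix m m' assume m: "m \<in> Ar Z" "m' \<in> Ar Z" "Cod Z m = Dom Z m'"
    have c: "Cod W (pair_ar (Far a m) (Far b m)) = Dom W (pair_ar (Far a m') (Far b m'))"
      by (rule ob_unique)
         (use m ar' hD(4)[OF ar'(1)[OF m(1)], symmetric] kD(4)[OF ar'(1)[OF m(1)], symmetric]
            hD(3)[OF ar'(1)[OF m(2)], symmetric] kD(3)[OF ar'(1)[OF m(2)], symmetric] aD(3,4) bD(3,4) in
           \<open>auto simp: W.dom_in W.cod_in Z.dom_in\<close>)
    note p = ar'(1)[OF m(1)] ar'(1)[OF m(2)] c
    show "pair_ar (Far a (Cmp Z m' m)) (Far b (Cmp Z m' m))
      = Cmp W (pair_ar (Far a m') (Far b m')) (pair_ar (Far a m) (Far b m))"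
      by (rule ar_unique)
         (use ar'[OF m(1)] ar'[OF m(2)] ar'[OF Z.cmp_in[OF m]] hD(6)[OF p] kD(6)[OF p]
            aD(6)[OF m] bD(6)[OF m] W.cmp_in[OF p] in simp_all)
  qed (use ob' ar' in auto)
  have "fcomp h u = a" "fcomp k u = b"
    by (rule functor_eqI[OF fcomp_Fun[OF u h] a] functor_eqI[OF fcomp_Fun[OF u k] b];
        simp add: u_def ob' ar')+
  with u show ?thesis by blast
qed

lemma pairing_functor_unique:
  assumes u: "u \<in> Fun Z W" and v: "v \<in> Fun Z W"
    and "fcomp h u = fcomp h v" "fcomp k u = fcomp k v"
  shows "u = v"
proof (rule functor_eq_of_Ar[OF u v])
  fix m assume m: "m \<in> Ar Z"
  show "Far u m = Far v m"
    by (rule ar_unique)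
       (use fcomp_eqD(2)[OF assms(3) u m] fcomp_eqD(2)[OF assms(4) u m] FunD[OF u] FunD[OF v] m in auto)
qed

lemma pairing_transformation:
  assumes u: "u \<in> Fun Z W" and v: "v \<in> Fun Z W"
    and \<alpha>: "\<alpha> \<in> Nat (fcomp h u) (fcomp h v)" and \<beta>: "\<beta> \<in> Nat (fcomp k u) (fcomp k v)"
    and eq: "whisker f \<alpha> = whisker g \<beta>"
  shows "\<exists>!\<gamma>. \<gamma> \<in> Nat u v \<and> whisker h \<gamma> = \<alpha> \<and> whisker k \<gamma> = \<beta>"
proof -
  interpret Z: category Z using u by (rule FunD)
  note uD = FunD[OF u] and vD = FunD[OF v] and hD = FunD[OF h] and kD = FunD[OF k]
  have \<alpha>E: "At \<alpha> \<in> Ob Z \<rightarrow>\<^sub>E Ar A" and \<alpha>S: "NSrc \<alpha> = fcomp h u" "NTgt \<alpha> = fcomp h v"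
    and \<alpha>D: "\<And>z. z \<in> Ob Z \<Longrightarrow> Dom A (At \<alpha> z) = Fob h (Fob u z)"
      "\<And>z. z \<in> Ob Z \<Longrightarrow> Cod A (At \<alpha> z) = Fob h (Fob v z)"
    and \<alpha>N: "\<And>m. m \<in> Ar Z \<Longrightarrow> Cmp A (At \<alpha> (Cod Z m)) (Far h (Far u m))
       = Cmp A (Far h (Far v m)) (At \<alpha> (Dom Z m))"
    using \<alpha> uD(2) vD(2) hD(3) by (auto simp: Nat_def)
  have \<beta>E: "At \<beta> \<in> Ob Z \<rightarrow>\<^sub>E Ar B" and \<beta>S: "NSrc \<beta> = fcomp k u" "NTgt \<beta> = fcomp k v"
    and \<beta>D: "\<And>z. z \<in> Ob Z \<Longrightarrow> Dom B (At \<beta> z) = Fob k (Fob u z)"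
      "\<And>z. z \<in> Ob Z \<Longrightarrow> Cod B (At \<beta> z) = Fob k (Fob v z)"
    and \<beta>N: "\<And>m. m \<in> Ar Z \<Longrightarrow> Cmp B (At \<beta> (Cod Z m)) (Far k (Far u m))
       = Cmp B (Far k (Far v m)) (At \<beta> (Dom Z m))"
    using \<beta> uD(2) vD(2) kD(3) by (auto simp: Nat_def)
  have At_eq: "Far f (At \<alpha> z) = Far g (At \<beta> z)" if "z \<in> Ob Z" for z
  proof -
    have "At (whisker f \<alpha>) z = At (whisker g \<beta>) z" using eq by simp
    then show ?thesis using that uD(2) by (simp add: whisker_def \<alpha>S \<beta>S)
  qed
  define t where "t z = pair_ar (At \<alpha> z) (At \<beta> z)" for z
  have t: "t z \<in> Ar W" "Far h (t z) = At \<alpha> z" "Far k (t z) = At \<beta> z" if "z \<in> Ob Z" for z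
    using pair_ar[OF _ _ At_eq[OF that]] \<alpha>E \<beta>E that by (auto simp: t_def)
  have tD: "Dom W (t z) = Fob u z" if z: "z \<in> Ob Z" for z
    by (rule ob_unique)
       (use t[OF z] hD(10)[OF t(1)[OF z]] kD(10)[OF t(1)[OF z]] uD z \<alpha>D \<beta>D in \<open>auto simp: W.dom_in\<close>)
  have tC: "Cod W (t z) = Fob v z" if z: "z \<in> Ob Z" for z
    by (rule ob_unique)
       (use t[OF z] hD(11)[OF t(1)[OF z]] kD(11)[OF t(1)[OF z]] vD z \<alpha>D \<beta>D in \<open>auto simp: W.cod_in\<close>)
  have tN: "Cmp W (t (Cod Z m)) (Far u m) = Cmp W (Far v m) (t (Dom Z m))" if m: "m \<in> Ar Z" for m
  proof -
    have 1: "Far u m \<in> Ar W" "t (Cod Z m) \<in> Ar W" "Cod W (Far u m) = Dom W (t (Cod Z m))"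
      using m t tD uD by (auto simp: Z.cod_in)
    have 2: "t (Dom Z m) \<in> Ar W" "Far v m \<in> Ar W" "Cod W (t (Dom Z m)) = Dom W (Far v m)"
      using m t tC vD by (auto simp: Z.dom_in)
    show ?thesis
      by (rule ar_unique)
         (use hD(13)[OF 1] hD(13)[OF 2] kD(13)[OF 1] kD(13)[OF 2] W.cmp_in[OF 1] W.cmp_in[OF 2]
            t \<alpha>N[OF m] \<beta>N[OF m] m in \<open>auto simp: Z.dom_in Z.cod_in\<close>)
  qed
  define \<gamma> where "\<gamma> = \<lparr>NSrc = u, NTgt = v, At = restrict t (Ob Z)\<rparr>"
  have wh: "whisker h \<gamma>' = \<lparr>NSrc = fcomp h u, NTgt = fcomp h v, At = restrict (Far h \<circ> At \<gamma>') (Ob Z)\<rparr>"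
    and wk: "whisker k \<gamma>' = \<lparr>NSrc = fcomp k u, NTgt = fcomp k v, At = restrict (Far k \<circ> At \<gamma>') (Ob Z)\<rparr>"
    if "\<gamma>' \<in> Nat u v" for \<gamma>'
    using that uD(2) by (auto simp: whisker_def Nat_def)
  have \<gamma>: "\<gamma> \<in> Nat u v"
    using uD vD t tD tC tN by (auto simp: Nat_def \<gamma>_def Z.dom_in Z.cod_in)
  have "At (whisker h \<gamma>) = At \<alpha>"
    by (rule PiE_ext[OF _ \<alpha>E])
       (use t \<alpha>E in \<open>auto simp: wh[OF \<gamma>], auto simp: \<gamma>_def\<close>)
  then have wh\<gamma>: "whisker h \<gamma> = \<alpha>"
    using \<alpha>S by (intro ntrans.equality) (auto simp: wh[OF \<gamma>])
  have "At (whisker k \<gamma>) = At \<beta>"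
    by (rule PiE_ext[OF _ \<beta>E])
       (use t \<beta>E in \<open>auto simp: wk[OF \<gamma>], auto simp: \<gamma>_def\<close>)
  then have wk\<gamma>: "whisker k \<gamma> = \<beta>"
    using \<beta>S by (intro ntrans.equality) (auto simp: wk[OF \<gamma>])
  show ?thesis
  proof (rule ex1I[of _ \<gamma>])
    show "\<gamma> \<in> Nat u v \<and> whisker h \<gamma> = \<alpha> \<and> whisker k \<gamma> = \<beta>" using \<gamma> wh\<gamma> wk\<gamma> by blast
  next
    fix \<delta> assume \<delta>: "\<delta> \<in> Nat u v \<and> whisker h \<delta> = \<alpha> \<and> whisker k \<delta> = \<beta>"
    have \<delta>S: "NSrc \<delta> = u" "NTgt \<delta> = v" "At \<delta> \<in> Ob Z \<rightarrow>\<^sub>E Ar W"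
      using \<delta> uD by (auto simp: Nat_def)
    have "At \<delta> = At \<gamma>"
    proof (rule PiE_ext[OF \<delta>S(3)])
      show "At \<gamma> \<in> Ob Z \<rightarrow>\<^sub>E Ar W" using t by (auto simp: \<gamma>_def)
      fix z assume z: "z \<in> Ob Z"
      have \<delta>N: "\<delta> \<in> Nat u v" using \<delta> by simp
      have "At (whisker h \<delta>) z = Far h (At \<delta> z)" "At (whisker k \<delta>) z = Far k (At \<delta> z)"
        using z by (simp_all add: wh[OF \<delta>N] wk[OF \<delta>N])
      then have "At \<alpha> z = Far h (At \<delta> z)" "At \<beta> z = Far k (At \<delta> z)" using \<delta> by simp_all
      then have hk: "Far h (At \<delta> z) = At \<alpha> z" "Far k (At \<delta> z) = At \<beta> z" by simp_all
      show "At \<delta> z = At \<gamma> z"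
        by (rule ar_unique) (use z hk t[OF z] PiE_mem[OF \<delta>S(3) z] in \<open>simp_all add: \<gamma>_def\<close>)
    qed
    then show "\<delta> = \<gamma>" using \<delta>S by (intro ntrans.equality) (auto simp: \<gamma>_def)
  qed
qed

lemma two_pullback: "two_pullback h k f g"
  unfolding two_pullback_def FunD(2,3)[OF h] FunD(2,3)[OF k] FunD(2,3)[OF f] FunD(2,3)[OF g]
proof (intro conjI allI ballI impI)
  fix Z a b assume "a \<in> Fun Z A" "b \<in> Fun Z B" "fcomp f a = fcomp g b"
  then show "\<exists>!u. u \<in> Fun Z W \<and> fcomp h u = a \<and> fcomp k u = b"
    using pairing_functor[of a Z b] pairing_functor_unique by metis
qed (simp_all add: FunD(1)[OF h] FunD(1)[OF k] FunD(1)[OF f] FunD(1)[OF g] commute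
       pairing_transformation)

end

lemma two_pullback_iff:
  assumes inf: "infinite (UNIV :: 'u set)"
    and h: "h \<in> Fun W A" and k: "k \<in> Fun W B" and f: "f \<in> Fun A D" and g: "g \<in> Fun B (D :: 'u cat)"
  shows "two_pullback h k f g \<longleftrightarrow> arrow_pullback W A B D h k f g"
proof
  assume "arrow_pullback W A B D h k f g"
  then show "two_pullback h k f g" by (rule arrow_pullback.two_pullback)
next
  assume pb: "two_pullback h k f g"
  have comm: "fcomp f h = fcomp g k" using pb by (simp add: two_pullback_def)
  have univ: "\<exists>!u. u \<in> Fun Z W \<and> fcomp h u = a \<and> fcomp k u = b"
    if "a \<in> Fun Z A" "b \<in> Fun Z B" "fcomp f a = fcomp g b" for Z :: "'u cat" and a b
    using pb that unfolding two_pullback_def FunD(2)[OF h] FunD(2)[OF f] FunD(2)[OF g] by blast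
  obtain Z :: "'u cat" and c where Z: "category Z" and c: "c \<in> Ar Z"
    and ex: "\<And>(D :: 'u cat) m. \<lbrakk>category D; m \<in> Ar D\<rbrakk> \<Longrightarrow> \<exists>F \<in> Fun Z D. Far F c = m"
    and un: "\<And>(D :: 'u cat) F G. \<lbrakk>F \<in> Fun Z D; G \<in> Fun Z D; Far F c = Far G c\<rbrakk> \<Longrightarrow> F = G"
    by (rule walking_arrow[OF inf]) blast
  have "pullback_on (Ar W) (Ar A) (Ar B) (Far h) (Far k) (Far f) (Far g)"
    unfolding pullback_on_def
  proof (intro ballI impI)
    fix x y assume xy: "x \<in> Ar A" "y \<in> Ar B" "Far f x = Far g y"
    obtain a where a: "a \<in> Fun Z A" "Far a c = x" using ex xy FunD(5)[OF h] by blast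
    obtain b where b: "b \<in> Fun Z B" "Far b c = y" using ex xy FunD(5)[OF k] by blast
    have eq: "fcomp f a = fcomp g b"
      by (rule un[OF fcomp_Fun[OF a(1) f] fcomp_Fun[OF b(1) g]])
         (use a b c xy FunD(2)[OF a(1)] FunD(2)[OF b(1)] in simp)
    obtain u where u: "u \<in> Fun Z W" "fcomp h u = a" "fcomp k u = b"
      and u_un: "\<And>v. \<lbrakk>v \<in> Fun Z W; fcomp h v = a; fcomp k v = b\<rbrakk> \<Longrightarrow> v = u"
      using univ[OF a(1) b(1) eq] by (elim ex1E) blast
    show "\<exists>!w. w \<in> Ar W \<and> Far h w = x \<and> Far k w = y"
    proof (rule ex1I[of _ "Far u c"])
      show "Far u c \<in> Ar W \<and> Far h (Far u c) = x \<and> Far k (Far u c) = y"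
        using FunD(9)[OF u(1) c] fcomp_eqD(2)[OF u(2,1) c] fcomp_eqD(2)[OF u(3,1) c] a b by auto
    next
      fix w assume w: "w \<in> Ar W \<and> Far h w = x \<and> Far k w = y"
      obtain v where v: "v \<in> Fun Z W" "Far v c = w" using ex w FunD(4)[OF h] by blast
      have "fcomp h v = a" "fcomp k v = b"
        using un[OF fcomp_Fun[OF v(1) h] a(1)] un[OF fcomp_Fun[OF v(1) k] b(1)]
          FunD(2)[OF v(1)] w v a b c by auto
      then show "w = Far u c" using u_un[OF v(1)] v by simp
    qed
  qed
  then show "arrow_pullback W A B D h k f g"
    using h k f g comm by (intro arrow_pullback.intro)
qed

section \<open>Coproducts\<close>

locale coproduct =
  fixes A :: "nat \<Rightarrow> 'u cat" and T \<iota>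
  assumes inf: "infinite (UNIV :: 'u set)" and cop: "is_coproduct A T \<iota>"
begin

lemma inj_Fun: "\<iota> n \<in> Fun (A n) T"
  using cop by (simp add: is_coproduct_def)

lemma copair: "(\<And>n. h n \<in> Fun (A n) Z) \<Longrightarrow> \<exists>!k. k \<in> Fun T Z \<and> (\<forall>n. fcomp k (\<iota> n) = h n)"
  for Z :: "'u cat"
  using cop by (simp add: is_coproduct_def)

sublocale T: category T using inj_Fun by (rule FunD)

lemma A_category: "category (A n)" using inj_Fun by (rule FunD)

lemma retraction:
  assumes "x \<in> Ob (A n)"
  obtains k where "k \<in> Fun T (A n)" "fcomp k (\<iota> n) = id_functor (A n)"
proof -
  have "\<exists>!k. k \<in> Fun T (A n) \<and>
    (\<forall>m. fcomp k (\<iota> m) = (if m = n then id_functor (A n) else const_functor (A m) (A n) x))"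
    by (rule copair) (simp add: id_functor_Fun const_functor_Fun A_category assms)
  then show thesis using that by (metis (mono_tags))
qed

lemma ob_inj:
  assumes "x \<in> Ob (A n)" "y \<in> Ob (A n)" "Fob (\<iota> n) x = Fob (\<iota> n) y"
  shows "x = y"
proof -
  obtain k where k: "fcomp k (\<iota> n) = id_functor (A n)" using retraction[OF assms(1)] by metis
  then show ?thesis using fcomp_eqD(1)[OF k inj_Fun] assms by (metis id_functor_simps(3))
qed

lemma ar_inj:
  assumes "f \<in> Ar (A n)" "g \<in> Ar (A n)" "Far (\<iota> n) f = Far (\<iota> n) g"
  shows "f = g"
proof -
  interpret A: category "A n" by (rule A_category)
  obtain k where k: "fcomp k (\<iota> n) = id_functor (A n)" using retraction[OF A.dom_in[OF assms(1)]] by metis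
  then show ?thesis using fcomp_eqD(2)[OF k inj_Fun] assms by (metis id_functor_simps(4))
qed

lemma ob_disjoint:
  assumes "x \<in> Ob (A n)" "y \<in> Ob (A m)" "Fob (\<iota> n) x = Fob (\<iota> m) y"
  shows "n = m"
proof (rule ccontr)
  assume "n \<noteq> m"
  obtain Z :: "'u cat" where Z: "category Z" "Ob Z = UNIV" by (rule indiscrete_category[OF inf])
  obtain S :: "'u set" where "card S = 2" "finite S" using infinite_arbitrarily_large[OF inf] by blast
  then obtain b c :: 'u where bc: "b \<noteq> c" by (auto simp: card_2_iff)
  have "\<exists>!k. k \<in> Fun T Z \<and> (\<forall>i. fcomp k (\<iota> i) = const_functor (A i) Z (if i = n then b else c))"
    by (rule copair) (simp add: const_functor_Fun A_category Z)
  then obtain k where k: "\<And>i. fcomp k (\<iota> i) = const_functor (A i) Z (if i = n then b else c)" by blast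
  have "Fob k (Fob (\<iota> n) x) = b" "Fob k (Fob (\<iota> m) y) = c"
    using fcomp_eqD(1)[OF k inj_Fun assms(1)] fcomp_eqD(1)[OF k inj_Fun assms(2)] assms \<open>n \<noteq> m\<close> by auto
  then show False using assms(3) bc by simp
qed

lemma ar_disjoint:
  assumes "f \<in> Ar (A n)" "g \<in> Ar (A m)" "Far (\<iota> n) f = Far (\<iota> m) g"
  shows "n = m"
  by (rule ob_disjoint[of "Dom (A n) f" _ "Dom (A m) g"])
     (use assms FunD(10)[OF inj_Fun assms(1)] FunD(10)[OF inj_Fun assms(2)] in
       \<open>simp_all add: category.dom_in[OF A_category]\<close>)

lemma ar_surj:
  assumes "t \<in> Ar T"
  shows "\<exists>n. \<exists>f \<in> Ar (A n). t = Far (\<iota> n) f"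
proof -
  let ?S = "\<Union>n. Fob (\<iota> n) ` Ob (A n)" and ?A = "\<Union>n. Far (\<iota> n) ` Ar (A n)"
  note D = FunD[OF inj_Fun]
  interpret S: closed_subcat T ?S ?A
  proof
    fix t assume "t \<in> ?A"
    then obtain n f where "f \<in> Ar (A n)" "t = Far (\<iota> n) f" by blast
    then have "Dom T t = Fob (\<iota> n) (Dom (A n) f)" "Dom (A n) f \<in> Ob (A n)"
      "Cod T t = Fob (\<iota> n) (Cod (A n) f)" "Cod (A n) f \<in> Ob (A n)"
      by (simp_all add: D category.dom_in[OF A_category] category.cod_in[OF A_category])
    then show "Dom T t \<in> ?S" "Cod T t \<in> ?S" by blast+
  next
    fix x assume "x \<in> ?S"
    then obtain n y where y: "y \<in> Ob (A n)" "x = Fob (\<iota> n) y" by blast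
    then have "Idt T x = Far (\<iota> n) (Idt (A n) y)" "Idt (A n) y \<in> Ar (A n)"
      by (simp_all add: D category.idt_in[OF A_category])
    then show "Idt T x \<in> ?A" by blast
  next
    fix t s assume "t \<in> ?A" "s \<in> ?A" and ts: "Cod T t = Dom T s"
    then obtain n f m g where f: "f \<in> Ar (A n)" "t = Far (\<iota> n) f" and g: "g \<in> Ar (A m)" "s = Far (\<iota> m) g"
      by blast
    have *: "Fob (\<iota> n) (Cod (A n) f) = Fob (\<iota> m) (Dom (A m) g)" using ts f g by (simp add: D)
    have "n = m"
      by (rule ob_disjoint[OF _ _ *]) (use f g in \<open>simp_all add: category.cod_in category.dom_in A_category\<close>)
    note f = f[unfolded this] and * = *[unfolded this]
    have c: "Cod (A m) f = Dom (A m) g"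
      by (rule ob_inj[OF _ _ *]) (use f g in \<open>simp_all add: category.cod_in category.dom_in A_category\<close>)
    have "Cmp T s t = Far (\<iota> m) (Cmp (A m) g f)" "Cmp (A m) g f \<in> Ar (A m)"
      using f g c by (simp_all add: D(13) category.cmp_in[OF A_category])
    then show "Cmp T s t \<in> ?A" by blast
  qed (auto simp: D)
  let ?Z = "subcat T ?S ?A"
  have c: "corestrict (\<iota> n) ?Z \<in> Fun (A n) ?Z" for n
    by (rule S.corestrict_Fun[OF inj_Fun]) auto
  obtain k where k: "k \<in> Fun T ?Z" "\<And>n. fcomp k (\<iota> n) = corestrict (\<iota> n) ?Z"
    using copair[OF c] by blast
  have "\<exists>!k. k \<in> Fun T T \<and> (\<forall>n. fcomp k (\<iota> n) = \<iota> n)"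
    by (rule copair[OF inj_Fun])
  moreover have "fcomp (corestrict (id_functor ?Z) T) k \<in> Fun T T"
    by (rule fcomp_Fun[OF k(1) S.inclusion_Fun])
  moreover have "fcomp (fcomp (corestrict (id_functor ?Z) T) k) (\<iota> n) = \<iota> n" for n
    unfolding fcomp_assoc[OF inj_Fun k(1) S.inclusion_Fun] k(2)
  proof (rule functor_eq_of_Ar[OF fcomp_Fun[OF c S.inclusion_Fun] inj_Fun])
    fix f assume f: "f \<in> Ar (A n)"
    then have "Far (\<iota> n) f \<in> ?A" by blast
    then show "Far (fcomp (corestrict (id_functor ?Z) T) (corestrict (\<iota> n) ?Z)) f = Far (\<iota> n) f"
      using f by (simp add: D(2))
  qed
  moreover have "fcomp (id_functor T) (\<iota> n) = \<iota> n" for n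
    by (rule functor_eq_of_Ar[OF fcomp_Fun[OF inj_Fun id_functor_Fun] inj_Fun])
       (auto simp: D T.category_axioms)
  ultimately have "fcomp (corestrict (id_functor ?Z) T) k = id_functor T"
    using id_functor_Fun[OF T.category_axioms] by blast
  then have "Far (fcomp (corestrict (id_functor ?Z) T) k) t = t" using assms by simp
  moreover have "Far k t \<in> ?A" using FunD(9)[OF k(1) assms] by simp
  ultimately show ?thesis using FunD(2)[OF k(1)] assms by auto
qed

end

section \<open>Quotients by group actions\<close>

locale sym_set =
  fixes n :: nat and E :: "'b set" and a :: "(nat \<Rightarrow> nat) \<Rightarrow> 'b \<Rightarrow> 'b"
  assumes act_closed: "\<lbrakk>x \<in> E; \<sigma> \<in> Sym n\<rbrakk> \<Longrightarrow> a \<sigma> x \<in> E"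
    and act_id: "x \<in> E \<Longrightarrow> a id x = x"
    and act_comp: "\<lbrakk>x \<in> E; \<sigma> \<in> Sym n; \<tau> \<in> Sym n\<rbrakk> \<Longrightarrow> a (\<sigma> \<circ> \<tau>) x = a \<tau> (a \<sigma> x)"
begin

definition orbit_eq :: "'b \<Rightarrow> 'b \<Rightarrow> bool" where
  "orbit_eq x y \<longleftrightarrow> (\<exists>\<sigma>\<in>Sym n. y = a \<sigma> x)"

lemma act_inv:
  assumes "x \<in> E" "\<sigma> \<in> Sym n"
  shows "inv \<sigma> \<in> Sym n" "a (inv \<sigma>) (a \<sigma> x) = x" "a \<sigma> (a (inv \<sigma>) x) = x"
proof -
  show "inv \<sigma> \<in> Sym n" using assms by (simp add: permutes_inv)
  then show "a (inv \<sigma>) (a \<sigma> x) = x" "a \<sigma> (a (inv \<sigma>) x) = x"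
    using act_comp[of x \<sigma> "inv \<sigma>"] act_comp[of x "inv \<sigma>" \<sigma>] assms
    by (auto simp: act_id permutes_inv_o)
qed

lemma orbit_eq_refl: "x \<in> E \<Longrightarrow> orbit_eq x x"
  unfolding orbit_eq_def by (rule bexI[of _ id]) (auto simp: act_id permutes_id)

lemma orbit_eq_sym: "\<lbrakk>orbit_eq x y; x \<in> E\<rbrakk> \<Longrightarrow> orbit_eq y x"
  unfolding orbit_eq_def using act_inv by metis

lemma orbit_eq_trans:
  assumes "orbit_eq x y" "orbit_eq y z" "x \<in> E"
  shows "orbit_eq x z"
proof -
  obtain \<sigma> \<tau> where "\<sigma> \<in> Sym n" "y = a \<sigma> x" "\<tau> \<in> Sym n" "z = a \<tau> y"
    using assms by (auto simp: orbit_eq_def)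
  then show ?thesis unfolding orbit_eq_def using assms(3) permutes_compose
    by (intro bexI[of _ "\<sigma> \<circ> \<tau>"]) (auto simp: act_comp)
qed

lemma orbit_code:
  assumes e: "inj_on (e :: 'b \<Rightarrow> 'c) E"
  shows "\<exists>r :: 'b \<Rightarrow> 'c. \<forall>x\<in>E. \<forall>y\<in>E. r x = r y \<longleftrightarrow> orbit_eq x y"
proof (intro exI ballI iffI)
  fix x y assume x: "x \<in> E" and y: "y \<in> E"
  have rep: "orbit_eq z (Eps (orbit_eq z)) \<and> Eps (orbit_eq z) \<in> E" if "z \<in> E" for z
    using someI[of "orbit_eq z", OF orbit_eq_refl[OF that]] that by (auto simp: orbit_eq_def act_closed)
  {
    assume "e (Eps (orbit_eq x)) = e (Eps (orbit_eq y))"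
    then have "Eps (orbit_eq x) = Eps (orbit_eq y)" using e rep[OF x] rep[OF y] by (auto dest: inj_onD)
    then show "orbit_eq x y"
      using rep[OF x] rep[OF y] x y orbit_eq_sym orbit_eq_trans by metis
  next
    assume xy: "orbit_eq x y"
    have "orbit_eq x z = orbit_eq y z" for z
      using xy x y orbit_eq_sym orbit_eq_trans by metis
    then have "orbit_eq x = orbit_eq y" by (rule ext)
    then show "e (Eps (orbit_eq x)) = e (Eps (orbit_eq y))" by simp
  }
qed

end

lemma image_category:
  fixes fo fa :: "'b \<Rightarrow> 'u"
  assumes C: "category C"
    and dom: "\<And>f g. \<lbrakk>f \<in> Ar C; g \<in> Ar C; fa f = fa g\<rbrakk> \<Longrightarrow> fo (Dom C f) = fo (Dom C g)"
    and cod: "\<And>f g. \<lbrakk>f \<in> Ar C; g \<in> Ar C; fa f = fa g\<rbrakk> \<Longrightarrow> fo (Cod C f) = fo (Cod C g)"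
    and idt: "\<And>x y. \<lbrakk>x \<in> Ob C; y \<in> Ob C; fo x = fo y\<rbrakk> \<Longrightarrow> fa (Idt C x) = fa (Idt C y)"
    and lift: "\<And>x g. \<lbrakk>x \<in> Ob C; g \<in> Ar C; fo x = fo (Dom C g)\<rbrakk>
      \<Longrightarrow> \<exists>g'\<in>Ar C. fa g' = fa g \<and> Dom C g' = x"
    and cmp: "\<And>f g f' g'. \<lbrakk>f \<in> Ar C; g \<in> Ar C; Cod C f = Dom C g; f' \<in> Ar C; g' \<in> Ar C;
      Cod C f' = Dom C g'; fa f = fa f'; fa g = fa g'\<rbrakk> \<Longrightarrow> fa (Cmp C g f) = fa (Cmp C g' f')"
  shows "\<exists>Z. category Z \<and> mk_functor C Z fo fa \<in> Fun C Z"
proof -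
  interpret C: category C by fact
  define so where "so = inv_into (Ob C) fo"
  define sa where "sa = inv_into (Ar C) fa"
  define Z where "Z = \<lparr>Ob = fo ` Ob C, Ar = fa ` Ar C, Dom = \<lambda>t. fo (Dom C (sa t)),
    Cod = \<lambda>t. fo (Cod C (sa t)), Idt = \<lambda>x. fa (Idt C (so x)),
    Cmp = \<lambda>t s. fa (Cmp C (SOME g. g \<in> Ar C \<and> fa g = t \<and> Dom C g = Cod C (sa s)) (sa s))\<rparr>"
  have sa: "sa (fa f) \<in> Ar C" "fa (sa (fa f)) = fa f" if "f \<in> Ar C" for f
    using that by (auto simp: sa_def inv_into_into f_inv_into_f)
  have so: "so (fo x) \<in> Ob C" "fo (so (fo x)) = fo x" if "x \<in> Ob C" for x
    using that by (auto simp: so_def inv_into_into f_inv_into_f)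
  have Z [simp]: "Ob Z = fo ` Ob C" "Ar Z = fa ` Ar C" by (auto simp: Z_def)
  have D: "Dom Z (fa f) = fo (Dom C f)" "Cod Z (fa f) = fo (Cod C f)" if "f \<in> Ar C" for f
    using dom[OF sa(1) that sa(2)] cod[OF sa(1) that sa(2)] that by (simp_all add: Z_def)
  have I: "Idt Z (fo x) = fa (Idt C x)" if "x \<in> Ob C" for x
    using idt[OF so(1) that so(2)] that by (simp add: Z_def)
  have K: "Cmp Z (fa g) (fa f) = fa (Cmp C g f)"
    if fg: "f \<in> Ar C" "g \<in> Ar C" "Cod C f = Dom C g" for f g
  proof -
    let ?P = "\<lambda>h. h \<in> Ar C \<and> fa h = fa g \<and> Dom C h = Cod C (sa (fa f))"
    have "fo (Cod C (sa (fa f))) = fo (Dom C g)" using cod[OF sa(1) fg(1) sa(2)] fg by simp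
    then have "\<exists>h. ?P h" using lift[of "Cod C (sa (fa f))" g] C.cod_in sa(1) fg by blast
    from someI_ex[OF this] have "?P (Eps ?P)" .
    then have P: "Eps ?P \<in> Ar C" "fa (Eps ?P) = fa g" "Cod C (sa (fa f)) = Dom C (Eps ?P)" by auto
    have "fa (Cmp C (Eps ?P) (sa (fa f))) = fa (Cmp C g f)"
      by (rule cmp) (fact P fg sa(1)[OF fg(1)] sa(2)[OF fg(1)])+
    then show ?thesis by (simp add: Z_def)
  qed
  have comp: "\<exists>g'\<in>Ar C. fa g' = fa g \<and> Cod C f = Dom C g'"
    if "f \<in> Ar C" "g \<in> Ar C" "Cod Z (fa f) = Dom Z (fa g)" for f g
    using lift[of "Cod C f" g] that by (auto simp: D C.cod_in)
  have "category Z"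
  proof
    fix t s assume "t \<in> Ar Z" "s \<in> Ar Z" "Cod Z t = Dom Z s"
    then obtain f g where *: "f \<in> Ar C" "g \<in> Ar C" "Cod C f = Dom C g" "t = fa f" "s = fa g"
      using comp by (auto simp: image_iff) metis
    then show "Cmp Z s t \<in> Ar Z" "Dom Z (Cmp Z s t) = Dom Z t" "Cod Z (Cmp Z s t) = Cod Z s"
      by (auto simp: K D C.cmp_in C.dom_cmp C.cod_cmp)
  next
    fix t s r assume "t \<in> Ar Z" "s \<in> Ar Z" "r \<in> Ar Z" "Cod Z t = Dom Z s" "Cod Z s = Dom Z r"
    then obtain f g h where *: "f \<in> Ar C" "g \<in> Ar C" "Cod C f = Dom C g" "t = fa f" "s = fa g"
      "h \<in> Ar C" "Cod C g = Dom C h" "r = fa h"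
      using comp by (auto simp: image_iff) metis
    then show "Cmp Z r (Cmp Z s t) = Cmp Z (Cmp Z r s) t"
      by (auto simp: K C.cmp_in C.dom_cmp C.cod_cmp C.cmp_assoc)
  next
    fix t assume "t \<in> Ar Z"
    then obtain f where f: "f \<in> Ar C" "t = fa f" by auto
    then show "Dom Z t \<in> Ob Z" "Cod Z t \<in> Ob Z" "Cmp Z t (Idt Z (Dom Z t)) = t"
      "Cmp Z (Idt Z (Cod Z t)) t = t"
      by (auto simp: D I K C.dom_in C.cod_in C.idt_in C.dom_idt C.cod_idt C.cmp_idt_left C.cmp_idt_right)
  qed (auto simp: I D C.idt_in C.dom_idt C.cod_idt)
  moreover from this have "mk_functor C Z fo fa \<in> Fun C Z"
    by (intro mk_functor_Fun[OF C]) (auto simp: D I K)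
  ultimately show ?thesis by blast
qed

locale sym_quotient =
  fixes n :: nat and C :: "'b cat" and R :: "(nat \<Rightarrow> nat) \<Rightarrow> ('b, 'b) cfunctor"
    and Q :: "'u cat" and q :: "('b, 'u) cfunctor"
  assumes inf: "infinite (UNIV :: 'u set)"
    and R_Fun: "\<sigma> \<in> Sym n \<Longrightarrow> R \<sigma> \<in> Fun C C"
    and R_ob: "sym_set n (Ob C) (\<lambda>\<sigma>. Fob (R \<sigma>))"
    and R_ar: "sym_set n (Ar C) (\<lambda>\<sigma>. Far (R \<sigma>))"
    and q_Fun: "q \<in> Fun C Q"
    and q_inv: "\<sigma> \<in> Sym n \<Longrightarrow> fcomp q (R \<sigma>) = q"
    and q_univ: "\<And>Z :: 'u cat. \<And>h. \<lbrakk>h \<in> Fun C Z; \<And>\<sigma>. \<sigma> \<in> Sym n \<Longrightarrow> fcomp h (R \<sigma>) = h\<rbrakk>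
      \<Longrightarrow> \<exists>!k. k \<in> Fun Q Z \<and> fcomp k q = h"
begin

sublocale C: category C using q_Fun by (rule FunD)
sublocale Q: category Q using q_Fun by (rule FunD)
sublocale ob: sym_set n "Ob C" "\<lambda>\<sigma>. Fob (R \<sigma>)" by (rule R_ob)
sublocale ar: sym_set n "Ar C" "\<lambda>\<sigma>. Far (R \<sigma>)" by (rule R_ar)

lemma orbit_eq_dom: "\<lbrakk>ar.orbit_eq f g; f \<in> Ar C\<rbrakk> \<Longrightarrow> ob.orbit_eq (Dom C f) (Dom C g)"
  and orbit_eq_cod: "\<lbrakk>ar.orbit_eq f g; f \<in> Ar C\<rbrakk> \<Longrightarrow> ob.orbit_eq (Cod C f) (Cod C g)"
  using FunD(10,11)[OF R_Fun] by (auto simp: ar.orbit_eq_def ob.orbit_eq_def)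

lemma lift:
  assumes "g \<in> Ar C" "ob.orbit_eq (Dom C g) x"
  shows "\<exists>g'\<in>Ar C. ar.orbit_eq g g' \<and> Dom C g' = x"
proof -
  obtain \<sigma> where "\<sigma> \<in> Sym n" "x = Fob (R \<sigma>) (Dom C g)" using assms by (auto simp: ob.orbit_eq_def)
  then show ?thesis using assms FunD(9,10)[OF R_Fun]
    by (intro bexI[of _ "Far (R \<sigma>) g"]) (auto simp: ar.orbit_eq_def)
qed

lemma kernel_ob:
  assumes x: "x \<in> Ob C" and y: "y \<in> Ob C"
  shows "Fob q x = Fob q y \<longleftrightarrow> ob.orbit_eq x y"
proof
  assume "ob.orbit_eq x y"
  then show "Fob q x = Fob q y" using fcomp_eqD(1)[OF q_inv R_Fun] x by (auto simp: ob.orbit_eq_def)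
next
  assume eq: "Fob q x = Fob q y"
  obtain Z :: "'u cat" where Z: "category Z" "Ob Z = UNIV"
    and Z_Fun: "\<And>(C :: 'b cat) (fo :: 'b \<Rightarrow> 'u). category C \<Longrightarrow> \<exists>F \<in> Fun C Z. \<forall>x\<in>Ob C. Fob F x = fo x"
    and Z_ar: "\<And>f g. \<lbrakk>Dom Z f = Dom Z g; Cod Z f = Cod Z g\<rbrakk> \<Longrightarrow> f = g"
    by (rule indiscrete_category[OF inf]) blast
  obtain S :: "'u set" where "card S = 2" "finite S" using infinite_arbitrarily_large[OF inf] by blast
  then obtain b c :: 'u where bc: "b \<noteq> c" by (auto simp: card_2_iff)
  obtain F where F: "F \<in> Fun C Z" "\<And>z. z \<in> Ob C \<Longrightarrow> Fob F z = (if ob.orbit_eq x z then b else c)"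
    using Z_Fun[OF C.category_axioms, of "\<lambda>z. if ob.orbit_eq x z then b else c"] by blast
  have F_inv: "Fob F (Fob (R \<sigma>) z) = Fob F z" if "\<sigma> \<in> Sym n" "z \<in> Ob C" for \<sigma> z
  proof -
    have z': "Fob (R \<sigma>) z \<in> Ob C" "ob.orbit_eq z (Fob (R \<sigma>) z)"
      using that ob.act_closed by (auto simp: ob.orbit_eq_def)
    then have "ob.orbit_eq x z \<longleftrightarrow> ob.orbit_eq x (Fob (R \<sigma>) z)"
      using ob.orbit_eq_trans[of x] ob.orbit_eq_sym that x by blast
    then show ?thesis using F z' that by simp
  qed
  have "fcomp F (R \<sigma>) = F" if \<sigma>: "\<sigma> \<in> Sym n" for \<sigma>
  proof (rule functor_eq_of_Ar[OF fcomp_Fun[OF R_Fun[OF \<sigma>] F(1)] F(1)])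
    fix f assume f: "f \<in> Ar C"
    have f': "Far (R \<sigma>) f \<in> Ar C" using \<sigma> f ar.act_closed by blast
    have "Far F (Far (R \<sigma>) f) = Far F f"
      by (rule Z_ar; use f f' \<sigma> in
        \<open>simp add: FunD(10,11)[OF F(1)] FunD(10,11)[OF R_Fun[OF \<sigma>]] F_inv C.dom_in C.cod_in\<close>)
    then show "Far (fcomp F (R \<sigma>)) f = Far F f" using f FunD(2)[OF R_Fun[OF \<sigma>]] by simp
  qed
  then obtain k where k: "fcomp k q = F" using q_univ[OF F(1)] by blast
  have "Fob F x = Fob F y" using fcomp_eqD(1)[OF k q_Fun] x y eq by metis
  then show "ob.orbit_eq x y" using F x y bc ob.orbit_eq_refl[OF x] by (auto split: if_splits)
qed

lemma kernel_ar_orbit: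
  assumes "f \<in> Ar C" "ar.orbit_eq f g"
  shows "Far q f = Far q g"
  using fcomp_eqD(2)[OF q_inv R_Fun] assms by (auto simp: ar.orbit_eq_def)

lemma ar_surj: "Far q ` Ar C = Ar Q"
proof
  show "Far q ` Ar C \<subseteq> Ar Q" using FunD(9)[OF q_Fun] by auto
  let ?S = "Fob q ` Ob C" and ?A = "Far q ` Ar C"
  note D = FunD[OF q_Fun]
  interpret S: closed_subcat Q ?S ?A
  proof
    fix t s assume "t \<in> ?A" "s \<in> ?A" and ts: "Cod Q t = Dom Q s"
    then obtain f g where f: "f \<in> Ar C" "t = Far q f" and g: "g \<in> Ar C" "s = Far q g" by blast
    have "Fob q (Dom C g) = Fob q (Cod C f)" using ts f g by (simp add: D)
    then have "ob.orbit_eq (Dom C g) (Cod C f)" using f g by (simp add: kernel_ob C.dom_in C.cod_in)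
    then obtain g' where g': "g' \<in> Ar C" "ar.orbit_eq g g'" "Dom C g' = Cod C f" using lift[OF g(1)] by blast
    then have "Cmp Q s t = Far q (Cmp C g' f)" "Cmp C g' f \<in> Ar C"
      using f g kernel_ar_orbit[OF g(1) g'(2)] by (simp_all add: D C.cmp_in)
    then show "Cmp Q s t \<in> ?A" by blast
  qed (auto simp: D C.dom_in C.cod_in C.idt_in simp flip: D(12))
  let ?Z = "subcat Q ?S ?A"
  have c: "corestrict q ?Z \<in> Fun C ?Z" by (rule S.corestrict_Fun[OF q_Fun]) auto
  have "fcomp (corestrict q ?Z) (R \<sigma>) = corestrict q ?Z" if \<sigma>: "\<sigma> \<in> Sym n" for \<sigma>
    by (rule functor_eq_of_Ar[OF fcomp_Fun[OF R_Fun[OF \<sigma>] c] c])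
       (use fcomp_eqD(2)[OF q_inv[OF \<sigma>] R_Fun[OF \<sigma>]] FunD(2)[OF R_Fun[OF \<sigma>]] ar.act_closed \<sigma> in
         \<open>simp add: D(2)\<close>)
  then obtain k where k: "k \<in> Fun Q ?Z" "fcomp k q = corestrict q ?Z" using q_univ[OF c] by blast
  have "\<exists>!k. k \<in> Fun Q Q \<and> fcomp k q = q" by (rule q_univ[OF q_Fun q_inv])
  moreover have "fcomp (corestrict (id_functor ?Z) Q) k \<in> Fun Q Q"
    by (rule fcomp_Fun[OF k(1) S.inclusion_Fun])
  moreover have "fcomp (fcomp (corestrict (id_functor ?Z) Q) k) q = q"
    unfolding fcomp_assoc[OF q_Fun k(1) S.inclusion_Fun] k(2)
    by (rule functor_eq_of_Ar[OF fcomp_Fun[OF c S.inclusion_Fun] q_Fun]) (auto simp: D)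
  moreover have "fcomp (id_functor Q) q = q"
    by (rule functor_eq_of_Ar[OF fcomp_Fun[OF q_Fun id_functor_Fun] q_Fun])
       (auto simp: D Q.category_axioms)
  ultimately have *: "fcomp (corestrict (id_functor ?Z) Q) k = id_functor Q"
    using id_functor_Fun[OF Q.category_axioms] by blast
  show "Ar Q \<subseteq> ?A"
  proof
    fix t assume t: "t \<in> Ar Q"
    have "Far (fcomp (corestrict (id_functor ?Z) Q) k) t = t" using * t by simp
    moreover have "Far k t \<in> ?A" using FunD(9)[OF k(1) t] by simp
    ultimately show "t \<in> ?A" using FunD(2)[OF k(1)] t by simp
  qed
qed

text \<open>
  For a free action the orbits of arrows form a category: composable arrows \<open>f, g\<close> and
  \<open>f \<cdot> \<sigma>, g \<cdot> \<tau>\<close> force \<open>\<sigma> = \<tau>\<close>, so composites of representatives stay in one orbit. Otherwise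
  the quotient may identify further arrows.
\<close>

lemma kernel_ar:
  assumes free: "\<And>\<sigma> x. \<lbrakk>\<sigma> \<in> Sym n; x \<in> Ob C; Fob (R \<sigma>) x = x\<rbrakk> \<Longrightarrow> \<sigma> = id"
    and e: "inj_on (eo :: 'b \<Rightarrow> 'u) (Ob C)" "inj_on (ea :: 'b \<Rightarrow> 'u) (Ar C)"
    and f: "f \<in> Ar C" and g: "g \<in> Ar C"
  shows "Far q f = Far q g \<longleftrightarrow> ar.orbit_eq f g"
proof
  assume "ar.orbit_eq f g"
  then show "Far q f = Far q g" by (rule kernel_ar_orbit[OF f])
next
  assume eq: "Far q f = Far q g"
  obtain fo :: "'b \<Rightarrow> 'u" where fo: "\<And>x y. \<lbrakk>x \<in> Ob C; y \<in> Ob C\<rbrakk> \<Longrightarrow> fo x = fo y \<longleftrightarrow> ob.orbit_eq x y"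
    using ob.orbit_code[OF e(1)] by blast
  obtain fa :: "'b \<Rightarrow> 'u" where fa: "\<And>x y. \<lbrakk>x \<in> Ar C; y \<in> Ar C\<rbrakk> \<Longrightarrow> fa x = fa y \<longleftrightarrow> ar.orbit_eq x y"
    using ar.orbit_code[OF e(2)] by blast
  have "\<exists>Z. category Z \<and> mk_functor C Z fo fa \<in> Fun C Z"
  proof (rule image_category)
    show "category C" by unfold_locales
    fix f g assume "f \<in> Ar C" "g \<in> Ar C" "fa f = fa g"
    then show "fo (Dom C f) = fo (Dom C g)" "fo (Cod C f) = fo (Cod C g)"
      by (simp_all add: fo fa C.dom_in C.cod_in orbit_eq_dom orbit_eq_cod)
  next
    fix x y assume "x \<in> Ob C" "y \<in> Ob C" "fo x = fo y"
    then show "fa (Idt C x) = fa (Idt C y)"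
      using FunD(12)[OF R_Fun] by (auto simp: fo fa C.idt_in ob.orbit_eq_def ar.orbit_eq_def)
  next
    fix x g assume "x \<in> Ob C" "g \<in> Ar C" "fo x = fo (Dom C g)"
    then have "ob.orbit_eq (Dom C g) x" by (simp add: fo C.dom_in ob.orbit_eq_sym)
    then obtain g' where "g' \<in> Ar C" "ar.orbit_eq g g'" "Dom C g' = x" using lift \<open>g \<in> Ar C\<close> by blast
    moreover from this have "fa g' = fa g" using fa[of g g'] \<open>g \<in> Ar C\<close> by simp
    ultimately show "\<exists>g'\<in>Ar C. fa g' = fa g \<and> Dom C g' = x" by blast
  next
    fix f g f' g' assume a: "f \<in> Ar C" "g \<in> Ar C" "Cod C f = Dom C g"
      and a': "f' \<in> Ar C" "g' \<in> Ar C" "Cod C f' = Dom C g'" and "fa f = fa f'" "fa g = fa g'"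
    then obtain \<sigma> \<tau> where \<sigma>: "\<sigma> \<in> Sym n" "f' = Far (R \<sigma>) f" and \<tau>: "\<tau> \<in> Sym n" "g' = Far (R \<tau>) g"
      by (auto simp: fa ar.orbit_eq_def)
    let ?x = "Dom C g"
    have x: "?x \<in> Ob C" using a by (simp add: C.dom_in)
    have \<sigma>\<tau>: "Fob (R \<sigma>) ?x = Fob (R \<tau>) ?x"
      using a a' FunD(10)[OF R_Fun[OF \<tau>(1)], of g] FunD(11)[OF R_Fun[OF \<sigma>(1)], of f] \<sigma> \<tau> by simp
    have "Fob (R (\<sigma> \<circ> inv \<tau>)) ?x = ?x"
      using ob.act_comp[OF x \<sigma>(1) ob.act_inv(1)[OF x \<tau>(1)]] \<sigma>\<tau> ob.act_inv(2)[OF x \<tau>(1)] by simp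
    then have "\<sigma> \<circ> inv \<tau> = id"
      using free x \<sigma> \<tau> ob.act_inv(1)[OF x \<tau>(1)] by (auto intro: permutes_compose)
    then have "\<sigma> = \<tau>" using \<tau>(1) by (metis comp_assoc comp_id id_comp mem_Collect_eq permutes_inv_o(2))
    then have "Cmp C g' f' = Far (R \<sigma>) (Cmp C g f)" using FunD(13)[OF R_Fun[OF \<sigma>(1)] a] \<sigma> \<tau> by simp
    then show "fa (Cmp C g f) = fa (Cmp C g' f')"
      using fa[OF C.cmp_in[OF a] C.cmp_in[OF a']] \<sigma>(1) by (auto simp: ar.orbit_eq_def)
  qed
  then obtain Z where F: "mk_functor C Z fo fa \<in> Fun C Z" (is "?F \<in> _") by blast
  have "fcomp ?F (R \<sigma>) = ?F" if \<sigma>: "\<sigma> \<in> Sym n" for \<sigma>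
  proof (rule functor_eq_of_Ar[OF fcomp_Fun[OF R_Fun[OF \<sigma>] F] F])
    fix f assume f: "f \<in> Ar C"
    have f': "Far (R \<sigma>) f \<in> Ar C" using \<sigma> f ar.act_closed by blast
    have "fa f = fa (Far (R \<sigma>) f)" unfolding fa[OF f f'] ar.orbit_eq_def using \<sigma> by blast
    then show "Far (fcomp ?F (R \<sigma>)) f = Far ?F f" using f f' FunD(2)[OF R_Fun[OF \<sigma>]] by simp
  qed
  then obtain k where k: "fcomp k q = ?F" using q_univ[OF F] by blast
  have "Far ?F f = Far ?F g" using fcomp_eqD(2)[OF k q_Fun] f g eq by metis
  then show "ar.orbit_eq f g" using f g by (simp add: fa)
qed

end

section \<open>Orbits of tuples\<close>

definition tuples :: "'a set \<Rightarrow> nat \<Rightarrow> 'a list set" where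
  "tuples S n = {xs. length xs = n \<and> set xs \<subseteq> S}"

lemma tuplesD: "xs \<in> tuples S n \<Longrightarrow> length xs = n" "xs \<in> tuples S n \<Longrightarrow> set xs \<subseteq> S"
  by (auto simp: tuples_def)

lemma map_tuples: "\<lbrakk>xs \<in> tuples S n; f ` S \<subseteq> T\<rbrakk> \<Longrightarrow> map f xs \<in> tuples T n"
  by (auto simp: tuples_def)

lemma permute_tuples: "\<lbrakk>xs \<in> tuples S n; \<sigma> \<in> Sym n\<rbrakk> \<Longrightarrow> permute_list \<sigma> xs \<in> tuples S n"
  by (auto simp: tuples_def)

lemma concat_tuples:
  assumes "list_all2 (\<lambda>xs k. xs \<in> tuples S k) xss ks"
  shows "concat xss \<in> tuples S (sum_list ks)"
  using assms by (induction rule: list_all2_induct) (auto simp: tuples_def)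

lemma map_eq_concat:
  "map f xs = concat yss \<Longrightarrow> \<exists>xss. xs = concat xss \<and> map (map f) xss = yss"
proof (induction yss arbitrary: xs)
  case (Cons ys yss)
  then obtain us vs where "xs = us @ vs" "ys = map f us" "concat yss = map f vs"
    by (auto simp: map_eq_append_conv)
  moreover from this Cons.IH obtain xss where "vs = concat xss" "map (map f) xss = yss" by metis
  ultimately show ?case by (intro exI[of _ "us # xss"]) auto
qed simp

lemma sym_set_tuples:
  assumes "sym_set n E a"
  shows "sym_set n (E \<times> tuples S n) (\<lambda>\<sigma> (p, xs). (a \<sigma> p, permute_list \<sigma> xs))"
proof -
  interpret sym_set n E a by fact
  show ?thesis
    by unfold_locales
       (auto simp: act_closed act_id act_comp permute_tuples permute_list_compose dest: tuplesD(1))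
qed

locale sym_sequence =
  fixes E :: "nat \<Rightarrow> 'p set" and a :: "nat \<Rightarrow> (nat \<Rightarrow> nat) \<Rightarrow> 'p \<Rightarrow> 'p"
  assumes act: "sym_set n (E n) (a n)"
    and free: "\<lbrakk>\<sigma> \<in> Sym n; p \<in> E n; a n \<sigma> p = p\<rbrakk> \<Longrightarrow> \<sigma> = id"

text \<open>\<open>T\<close> is the set \<open>\<Coprod>\<^sub>n E(n) \<times>\<^bsub>\<Sigma>\<^sub>n\<^esub> S\<^sup>n\<close>, with \<open>b n p xs\<close> the class of \<open>(p, xs)\<close>.\<close>

locale orbit_set = sym_sequence E a
  for E :: "nat \<Rightarrow> 'p set" and a +
  fixes S :: "'s set" and T :: "'t set" and b :: "nat \<Rightarrow> 'p \<Rightarrow> 's list \<Rightarrow> 't"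
  assumes class_in: "\<lbrakk>p \<in> E n; xs \<in> tuples S n\<rbrakk> \<Longrightarrow> b n p xs \<in> T"
    and class_surj: "t \<in> T \<Longrightarrow> \<exists>n. \<exists>p\<in>E n. \<exists>xs\<in>tuples S n. t = b n p xs"
    and class_eq: "\<lbrakk>p \<in> E n; xs \<in> tuples S n; r \<in> E m; ys \<in> tuples S m\<rbrakk> \<Longrightarrow>
      b n p xs = b m r ys \<longleftrightarrow> n = m \<and> (\<exists>\<sigma>\<in>Sym n. r = a n \<sigma> p \<and> ys = permute_list \<sigma> xs)"
begin

lemma class_same_op:
  assumes "p \<in> E n" "xs \<in> tuples S n" "ys \<in> tuples S n" "b n p xs = b n p ys"
  shows "xs = ys"
proof -
  obtain \<sigma> where "\<sigma> \<in> Sym n" "p = a n \<sigma> p" "ys = permute_list \<sigma> xs"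
    using class_eq[of p n xs p n ys] assms by blast
  then show ?thesis using free[of \<sigma> n p] assms by simp
qed

lemma class_list:
  assumes "ss \<in> tuples T n"
  obtains ks ps xss where "length ks = n" "list_all2 (\<lambda>p k. p \<in> E k) ps ks"
    "list_all2 (\<lambda>xs k. xs \<in> tuples S k) xss ks"
    "ss = map (\<lambda>i. b (ks ! i) (ps ! i) (xss ! i)) [0..<length ks]"
proof -
  have "\<forall>i<n. \<exists>k p xs. p \<in> E k \<and> xs \<in> tuples S k \<and> ss ! i = b k p xs"
    using assms class_surj by (metis nth_mem subsetD tuplesD)
  then obtain fk fp fx where *: "\<And>i. i < n \<Longrightarrow>
      fp i \<in> E (fk i) \<and> fx i \<in> tuples S (fk i) \<and> ss ! i = b (fk i) (fp i) (fx i)"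
    by metis
  show thesis
    by (rule that[of "map fk [0..<n]" "map fp [0..<n]" "map fx [0..<n]"])
       (use * tuplesD(1)[OF assms] in \<open>auto simp: list_all2_conv_all_nth intro!: nth_equalityI\<close>)
qed

end

locale orbit_map =
  dom: orbit_set E a S T b + cod: orbit_set E a S' T' b'
  for E :: "nat \<Rightarrow> 'p set" and a and S :: "'s set" and T :: "'t set" and b
    and S' :: "'s1 set" and T' :: "'t1 set" and b' +
  fixes f :: "'s \<Rightarrow> 's1" and Tf :: "'t \<Rightarrow> 't1"
  assumes map_in: "f ` S \<subseteq> S'"
    and map_class: "\<lbrakk>p \<in> E n; xs \<in> tuples S n\<rbrakk> \<Longrightarrow> Tf (b n p xs) = b' n p (map f xs)"
begin

lemma preimage_class:
  assumes "t \<in> T" "p \<in> E n" "ys \<in> tuples S' n" "Tf t = b' n p ys"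
  shows "\<exists>xs\<in>tuples S n. t = b n p xs \<and> map f xs = ys"
proof -
  obtain m r zs where z: "r \<in> E m" "zs \<in> tuples S m" "t = b m r zs" using dom.class_surj[OF assms(1)] by blast
  then have "b' m r (map f zs) = b' n p ys" using assms by (simp add: map_class)
  then obtain \<sigma> where \<sigma>: "m = n" "\<sigma> \<in> Sym n" "p = a n \<sigma> r" "ys = permute_list \<sigma> (map f zs)"
    using cod.class_eq[OF z(1) map_tuples[OF z(2) map_in] assms(2,3)] by auto
  have len: "length zs = n" using tuplesD(1)[OF z(2)] \<sigma> by simp
  have zs': "permute_list \<sigma> zs \<in> tuples S n" using z \<sigma> by (simp add: permute_tuples)
  have "t = b n p (permute_list \<sigma> zs)"
    using z dom.class_eq[OF z(1,2) assms(2) zs'] \<sigma> by auto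
  moreover have "map f (permute_list \<sigma> zs) = ys" using \<sigma> len by (simp add: permute_list_map)
  ultimately show ?thesis using zs' by blast
qed

end

lemma orbit_pullback:
  assumes h: "orbit_map E a W TW bW A TA bA h Th" and k: "orbit_map E a W TW bW B TB bB k Tk"
    and f: "orbit_map E a A TA bA D TD bD f Tf" and g: "orbit_map E a B TB bB D TD bD g Tg"
    and comm: "\<And>w. w \<in> W \<Longrightarrow> f (h w) = g (k w)"
    and pb: "pullback_on W A B h k f g"
  shows "pullback_on TW TA TB Th Tk Tf Tg"
proof (rule pullback_onI)
  interpret h: orbit_map E a W TW bW A TA bA h Th by fact
  interpret k: orbit_map E a W TW bW B TB bB k Tk by fact
  interpret f: orbit_map E a A TA bA D TD bD f Tf by fact
  interpret g: orbit_map E a B TB bB D TD bD g Tg by fact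
  have uniq: "w = w'" if "w \<in> W" "w' \<in> W" "h w = h w'" "k w = k w'" for w w'
  proof -
    have "h w \<in> A" "k w \<in> B" using that h.map_in k.map_in by auto
    then have "\<exists>!v. v \<in> W \<and> h v = h w \<and> k v = k w"
      using pb comm[OF that(1)] unfolding pullback_on_def by blast
    then show ?thesis using that by (auto simp: Ex1_def)
  qed
  {
    fix x y assume x: "x \<in> TA" and y: "y \<in> TB" and eq: "Tf x = Tg y"
    obtain n p xs where xs: "p \<in> E n" "xs \<in> tuples A n" "x = bA n p xs" using h.cod.class_surj[OF x] by blast
    have "Tg y = bD n p (map f xs)" using eq xs f.map_class by simp
    then obtain ys where ys: "ys \<in> tuples B n" "y = bB n p ys" "map g ys = map f xs"
      using g.preimage_class[OF y xs(1) map_tuples[OF xs(2) f.map_in]] by blast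
    have "\<exists>w. w \<in> W \<and> h w = xs ! i \<and> k w = ys ! i" if "i < n" for i
    proof -
      have "xs ! i \<in> A" "ys ! i \<in> B" "f (xs ! i) = g (ys ! i)"
        using tuplesD[OF xs(2)] tuplesD[OF ys(1)] that ys(3) nth_map[of i xs f] nth_map[of i ys g]
        by (auto simp: subset_iff)
      then show ?thesis using pb unfolding pullback_on_def by blast
    qed
    then obtain w where w: "\<And>i. i < n \<Longrightarrow> w i \<in> W \<and> h (w i) = xs ! i \<and> k (w i) = ys ! i" by metis
    let ?ws = "map w [0..<n]"
    have "?ws \<in> tuples W n" "map h ?ws = xs" "map k ?ws = ys"
      using w tuplesD(1)[OF xs(2)] tuplesD(1)[OF ys(1)] by (auto simp: tuples_def intro!: nth_equalityI)
    then show "\<exists>w\<in>TW. Th w = x \<and> Tk w = y"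
      using xs ys h.dom.class_in h.map_class k.map_class by (intro bexI[of _ "bW n p ?ws"]) auto
  next
    fix w w' assume w: "w \<in> TW" "w' \<in> TW" and eq: "Th w = Th w'" "Tk w = Tk w'"
    obtain n p ws where ws: "p \<in> E n" "ws \<in> tuples W n" "w = bW n p ws" using h.dom.class_surj[OF w(1)] by blast
    have "Th w' = bA n p (map h ws)" using eq ws h.map_class by simp
    then obtain ws' where ws': "ws' \<in> tuples W n" "w' = bW n p ws'" "map h ws' = map h ws"
      using h.preimage_class[OF w(2) ws(1) map_tuples[OF ws(2) h.map_in]] by blast
    have "map k ws = map k ws'"
      by (rule k.cod.class_same_op[OF ws(1)])
         (use ws ws' eq k.map_class k.map_in in \<open>auto intro: map_tuples\<close>)
    have len: "length ws = n" "length ws' = n" using ws ws' by (auto dest: tuplesD)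
    have "ws = ws'"
    proof (rule nth_equalityI)
      fix i assume "i < length ws"
      then show "ws ! i = ws' ! i"
        using len tuplesD(2)[OF ws(2)] tuplesD(2)[OF ws'(1)] \<open>map k ws = map k ws'\<close> ws'(3)
        by (intro uniq) (auto simp: subset_iff list_eq_iff_nth_eq)
    qed (use len in simp)
    then show "w = w'" using ws ws' by simp
  }
qed

lemma orbit_unit_pullback:
  assumes F: "orbit_map E a X TX bX Y TY bY F TF" and e: "e \<in> E 1"
    and \<eta>: "\<And>x. x \<in> X \<Longrightarrow> \<eta>X x = bX 1 e [x]" "\<And>y. y \<in> Y \<Longrightarrow> \<eta>Y y = bY 1 e [y]"
  shows "pullback_on X Y TX F \<eta>X \<eta>Y TF"
proof (rule pullback_onI)
  interpret F: orbit_map E a X TX bX Y TY bY F TF by fact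
  {
    fix y t assume y: "y \<in> Y" and t: "t \<in> TX" and eq: "\<eta>Y y = TF t"
    have "[y] \<in> tuples Y 1" "TF t = bY 1 e [y]" using y eq \<eta>(2)[OF y] by (simp_all add: tuples_def)
    from F.preimage_class[OF t e this]
    obtain xs where xs: "xs \<in> tuples X 1" "t = bX 1 e xs" "map F xs = [y]" by metis
    then obtain x where x: "xs = [x]" "F x = y" by (auto simp: map_eq_Cons_conv)
    then have "x \<in> X" using xs(1) by (simp add: tuples_def)
    with x show "\<exists>x\<in>X. F x = y \<and> \<eta>X x = t" using xs(2) \<eta>(1) by metis
  next
    fix x x' assume "x \<in> X" "x' \<in> X" "\<eta>X x = \<eta>X x'"
    then show "x = x'" using F.dom.class_same_op[OF e, of "[x]" "[x']"] by (simp add: \<eta> tuples_def)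
  }
qed

lemma orbit_mult_pullback:
  assumes F: "orbit_map E a X TX bX Y TY bY F TF"
    and TF: "orbit_map E a TX TTX bbX TY TTY bbY TF TTF"
    and mu_in: "\<And>ks p ps. \<lbrakk>p \<in> E (length ks); list_all2 (\<lambda>p k. p \<in> E k) ps ks\<rbrakk>
      \<Longrightarrow> mu ks p ps \<in> E (sum_list ks)"
    and muX: "\<And>ks p ps xss. \<lbrakk>p \<in> E (length ks); list_all2 (\<lambda>p k. p \<in> E k) ps ks;
        list_all2 (\<lambda>xs k. xs \<in> tuples X k) xss ks\<rbrakk> \<Longrightarrow>
      \<mu>X (bbX (length ks) p (map (\<lambda>i. bX (ks ! i) (ps ! i) (xss ! i)) [0..<length ks]))
        = bX (sum_list ks) (mu ks p ps) (concat xss)"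
    and muY: "\<And>ks p ps xss. \<lbrakk>p \<in> E (length ks); list_all2 (\<lambda>p k. p \<in> E k) ps ks;
        list_all2 (\<lambda>xs k. xs \<in> tuples Y k) xss ks\<rbrakk> \<Longrightarrow>
      \<mu>Y (bbY (length ks) p (map (\<lambda>i. bY (ks ! i) (ps ! i) (xss ! i)) [0..<length ks]))
        = bY (sum_list ks) (mu ks p ps) (concat xss)"
  shows "pullback_on TTX TTY TX TTF \<mu>X \<mu>Y TF"
proof (rule pullback_onI)
  interpret F: orbit_map E a X TX bX Y TY bY F TF by fact
  interpret TF: orbit_map E a TX TTX bbX TY TTY bbY TF TTF by fact
  {
    fix s t assume s: "s \<in> TTY" and t: "t \<in> TX" and eq: "\<mu>Y s = TF t"
    obtain n p ss where ss: "p \<in> E n" "ss \<in> tuples TY n" "s = bbY n p ss" using TF.cod.class_surj[OF s] by blast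
    obtain ks ps yss where d: "length ks = n" "list_all2 (\<lambda>p k. p \<in> E k) ps ks"
      "list_all2 (\<lambda>xs k. xs \<in> tuples Y k) yss ks"
      "ss = map (\<lambda>i. bY (ks ! i) (ps ! i) (yss ! i)) [0..<length ks]"
      by (rule F.cod.class_list[OF ss(2)])
    have p: "p \<in> E (length ks)" using ss d by simp
    have "TF t = bY (sum_list ks) (mu ks p ps) (concat yss)" using eq ss d muY[OF p d(2,3)] by simp
    then obtain xs where xs: "xs \<in> tuples X (sum_list ks)" "t = bX (sum_list ks) (mu ks p ps) xs"
      "map F xs = concat yss"
      using F.preimage_class[OF t mu_in[OF p d(2)] concat_tuples[OF d(3)]] by blast
    then obtain xss where xss: "xs = concat xss" "map (map F) xss = yss" using map_eq_concat by metis
    have l: "length ps = n" "length xss = n" using d xss by (auto dest: list_all2_lengthD)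
    have "set (xss ! i) \<subseteq> X \<and> length (xss ! i) = ks ! i" if "i < n" for i
    proof -
      have "xss ! i \<in> set xss" using that l by simp
      moreover have "length (yss ! i) = ks ! i"
        using d that by (auto simp: list_all2_conv_all_nth tuples_def)
      ultimately show ?thesis using xs(1) xss l that by (force simp: tuples_def)
    qed
    then have xss_in: "list_all2 (\<lambda>xs k. xs \<in> tuples X k) xss ks"
      using l d by (auto simp: list_all2_conv_all_nth tuples_def)
    let ?us = "map (\<lambda>i. bX (ks ! i) (ps ! i) (xss ! i)) [0..<length ks]"
    have us: "?us \<in> tuples TX n"
      using d xss_in l by (auto simp: tuples_def list_all2_conv_all_nth intro!: F.dom.class_in)
    have "map TF ?us = ss"
      unfolding d(4) map_map
      by (rule map_cong) (use d xss_in l xss in \<open>auto simp: list_all2_conv_all_nth F.map_class\<close>)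
    then have "TTF (bbX n p ?us) = s" using ss us TF.map_class by simp
    moreover have "\<mu>X (bbX n p ?us) = t" using muX[OF p d(2) xss_in] d xs xss by simp
    moreover have "bbX n p ?us \<in> TTX" using ss us TF.dom.class_in by simp
    ultimately show "\<exists>w\<in>TTX. TTF w = s \<and> \<mu>X w = t" by blast
  next
    fix w w' assume w: "w \<in> TTX" "w' \<in> TTX" and eq: "TTF w = TTF w'" "\<mu>X w = \<mu>X w'"
    obtain n p ss where ss: "p \<in> E n" "ss \<in> tuples TX n" "w = bbX n p ss" using TF.dom.class_surj[OF w(1)] by blast
    have "TTF w' = bbY n p (map TF ss)" using eq ss TF.map_class by simp
    then obtain ss' where ss': "ss' \<in> tuples TX n" "w' = bbX n p ss'" "map TF ss' = map TF ss"
      using TF.preimage_class[OF w(2) ss(1) map_tuples[OF ss(2) TF.map_in]] by blast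
    obtain ks ps xss where d: "length ks = n" "list_all2 (\<lambda>p k. p \<in> E k) ps ks"
      "list_all2 (\<lambda>xs k. xs \<in> tuples X k) xss ks"
      "ss = map (\<lambda>i. bX (ks ! i) (ps ! i) (xss ! i)) [0..<length ks]"
      by (rule F.dom.class_list[OF ss(2)])
    have p: "p \<in> E (length ks)" using ss d by simp
    have "\<exists>xs\<in>tuples X (ks ! i). ss' ! i = bX (ks ! i) (ps ! i) xs" if i: "i < n" for i
    proof -
      have a: "ss' ! i \<in> TX" "ps ! i \<in> E (ks ! i)" "xss ! i \<in> tuples X (ks ! i)"
        using tuplesD[OF ss'(1)] d i by (auto simp: list_all2_conv_all_nth)
      have "TF (ss' ! i) = TF (ss ! i)"
        using ss'(3) i tuplesD(1)[OF ss'(1)] tuplesD(1)[OF ss(2)] by (auto simp: list_eq_iff_nth_eq)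
      also have "\<dots> = bY (ks ! i) (ps ! i) (map F (xss ! i))"
        using d i a by (simp add: F.map_class)
      finally show ?thesis using F.preimage_class[OF a(1,2) map_tuples[OF a(3) F.map_in]] by blast
    qed
    then obtain x' where x': "\<And>i. i < n \<Longrightarrow> x' i \<in> tuples X (ks ! i) \<and> ss' ! i = bX (ks ! i) (ps ! i) (x' i)"
      by metis
    define xss' where "xss' = map x' [0..<n]"
    have xss': "list_all2 (\<lambda>xs k. xs \<in> tuples X k) xss' ks"
      using x' d by (auto simp: xss'_def list_all2_conv_all_nth)
    have ss'_eq: "ss' = map (\<lambda>i. bX (ks ! i) (ps ! i) (xss' ! i)) [0..<length ks]"
      using x' d tuplesD(1)[OF ss'(1)] by (auto simp: xss'_def intro!: nth_equalityI)
    have "concat xss = concat xss'"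
      by (rule F.dom.class_same_op[OF mu_in[OF p d(2)] concat_tuples[OF d(3)] concat_tuples[OF xss']])
         (use muX[OF p d(2,3)] muX[OF p d(2) xss'] eq ss ss' ss'_eq d in simp)
    moreover have "length xss = length xss'" using list_all2_lengthD[OF d(3)] list_all2_lengthD[OF xss'] by simp
    moreover have "\<forall>(x, y)\<in>set (zip xss xss'). length x = length y"
      using d(3) xss' by (auto simp: list_all2_conv_all_nth in_set_zip tuples_def)
    ultimately have "xss = xss'" by (simp add: concat_eq_concat_iff)
    then show "w = w'" using ss ss' ss'_eq d by simp
  }
qed

section \<open>The categories \<open>P(n) \<times> X\<^sup>n\<close>\<close>

lemma bprod_simps [simp]:
  "Ob (bprod C D) = Ob C \<times> Ob D" "Ar (bprod C D) = Ar C \<times> Ar D"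
  "Dom (bprod C D) (f, f') = (Dom C f, Dom D f')" "Cod (bprod C D) (f, f') = (Cod C f, Cod D f')"
  "Idt (bprod C D) (x, x') = (Idt C x, Idt D x')"
  "Cmp (bprod C D) (g, g') (f, f') = (Cmp C g f, Cmp D g' f')"
  by (auto simp: bprod_def)

lemma discrete_simps [simp]:
  "Ob (discrete S) = S" "Ar (discrete S) = S" "Dom (discrete S) x = x" "Cod (discrete S) x = x"
  "Idt (discrete S) x = x" "Cmp (discrete S) x y = x"
  by (auto simp: discrete_def)

lemma discrete_category: "category (discrete S)"
  by (rule category.intro) auto

lemma discrete_Fun:
  assumes "f ` S \<subseteq> T"
  shows "mk_functor (discrete S) (discrete T) f f \<in> Fun (discrete S) (discrete T)"
  using assms by (intro mk_functor_Fun) (auto simp: discrete_category)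

lemma map2_replicate: "length xs = n \<Longrightarrow> map2 f (replicate n c) xs = map (f c) xs"
  by (induction xs arbitrary: n) auto

lemma cpower_simps [simp]:
  "Ob (cpower X n) = tuples (Ob X) n" "Ar (cpower X n) = tuples (Ar X) n"
  by (auto simp: lprod_def tuples_def list_all2_conv_all_nth subset_iff in_set_conv_nth)

lemma cpower_ops:
  "length fs = n \<Longrightarrow> Dom (cpower X n) fs = map (Dom X) fs"
  "length fs = n \<Longrightarrow> Cod (cpower X n) fs = map (Cod X) fs"
  "length xs = n \<Longrightarrow> Idt (cpower X n) xs = map (Idt X) xs"
  "\<lbrakk>length gs = n; length fs = n\<rbrakk> \<Longrightarrow> Cmp (cpower X n) gs fs = map2 (Cmp X) gs fs"
  by (auto simp: lprod_def map2_replicate intro!: nth_equalityI)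

definition perm_act :: "'u operad \<Rightarrow> nat \<Rightarrow> 'u cat \<Rightarrow> (nat \<Rightarrow> nat) \<Rightarrow>
    ('u \<times> 'u list, 'u \<times> 'u list) cfunctor" where
  "perm_act P n X \<sigma> = mk_functor (bprod (PC P n) (cpower X n)) (bprod (PC P n) (cpower X n))
     (\<lambda>(p, xs). (Fob (act P n \<sigma>) p, permute_list \<sigma> xs))
     (\<lambda>(f, fs). (Far (act P n \<sigma>) f, permute_list \<sigma> fs))"

lemma perm_act_Fun:
  assumes P: "symmetric_operad P" and C: "category (bprod (PC P n) (cpower X n))"
    and \<sigma>: "\<sigma> \<in> Sym n"
  shows "perm_act P n X \<sigma> \<in> Fun (bprod (PC P n) (cpower X n)) (bprod (PC P n) (cpower X n))"
proof -
  interpret symmetric_operad P by fact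
  note D = FunD[OF act_fun[OF \<sigma>]]
  have \<sigma>': "\<sigma> permutes {..<n}" using \<sigma> by simp
  have ops: "Dom (cpower X n) (permute_list \<sigma> xs) = permute_list \<sigma> (Dom (cpower X n) xs)"
    "Cod (cpower X n) (permute_list \<sigma> xs) = permute_list \<sigma> (Cod (cpower X n) xs)"
    "Idt (cpower X n) (permute_list \<sigma> xs) = permute_list \<sigma> (Idt (cpower X n) xs)"
    if "xs \<in> tuples S n" for xs S
    using tuplesD(1)[OF that] \<sigma>' by (simp_all add: cpower_ops permute_list_map)
  show ?thesis unfolding perm_act_def
  proof (rule mk_functor_Fun[OF C C])
    fix f g assume "f \<in> Ar (bprod (PC P n) (cpower X n))" "g \<in> Ar (bprod (PC P n) (cpower X n))"
      and fg: "Cod (bprod (PC P n) (cpower X n)) f = Dom (bprod (PC P n) (cpower X n)) g"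
    then obtain f1 fs g1 gs where *: "f = (f1, fs)" "g = (g1, gs)" "f1 \<in> Ar (PC P n)" "g1 \<in> Ar (PC P n)"
      "length fs = n" "length gs = n" by (auto simp: tuples_def)
    have "permute_list \<sigma> (map2 (Cmp X) gs fs) = map2 (Cmp X) (permute_list \<sigma> gs) (permute_list \<sigma> fs)"
      using * \<sigma>' by (simp add: permute_list_map permute_list_zip)
    then show "(\<lambda>(f, fs). (Far (act P n \<sigma>) f, permute_list \<sigma> fs)) (Cmp (bprod (PC P n) (cpower X n)) g f) =
      Cmp (bprod (PC P n) (cpower X n)) ((\<lambda>(f, fs). (Far (act P n \<sigma>) f, permute_list \<sigma> fs)) g)
         ((\<lambda>(f, fs). (Far (act P n \<sigma>) f, permute_list \<sigma> fs)) f)"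
      using fg by (simp add: * D(13) cpower_ops)
  qed (use \<sigma> in \<open>auto simp: D permute_tuples ops\<close>)
qed

locale operad_monad = symmetric_operad P + operad_two_monad P q \<iota> M
  for P :: "'u operad" and q \<iota> and M :: "'u two_monad" +
  assumes inf: "infinite (UNIV :: 'u set)"
begin

abbreviation PX :: "nat \<Rightarrow> 'u cat \<Rightarrow> ('u \<times> 'u list) cat" where
  "PX n X \<equiv> bprod (PC P n) (cpower X n)"

lemma q_Fun: "category X \<Longrightarrow> q n X \<in> Fun (PX n X) (Tgt (q n X))"
  using coeq[of X n] by (auto simp: is_coequalizer_def Fun_def act_left_def)

lemma PX_category: "category X \<Longrightarrow> category (PX n X)"
  using q_Fun by (rule FunD)

lemma act_ob: "sym_set n (Ob (PC P n)) (\<lambda>\<sigma>. Fob (act P n \<sigma>))"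
proof -
  interpret operad_laws "\<lambda>n. Ob (PC P n)" "\<lambda>n \<sigma>. Fob (act P n \<sigma>)" "\<lambda>ks. Fob (opmu P ks)" "opid P"
    by (rule laws_ob)
  show ?thesis by unfold_locales (auto simp: act_id act_comp FunD(8)[OF act_fun])
qed

lemma act_ar: "sym_set n (Ar (PC P n)) (\<lambda>\<sigma>. Far (act P n \<sigma>))"
proof -
  interpret operad_laws "\<lambda>n. Ar (PC P n)" "\<lambda>n \<sigma>. Far (act P n \<sigma>)" "\<lambda>ks. Far (opmu P ks)" "Idt (PC P 1) (opid P)"
    by (rule laws_ar)
  show ?thesis by unfold_locales (auto simp: act_id act_comp FunD(9)[OF act_fun])
qed

lemma perm_act_apply:
  "x \<in> Ob (PX n X) \<Longrightarrow> Fob (perm_act P n X \<sigma>) x = (case x of (p, xs) \<Rightarrow> (Fob (act P n \<sigma>) p, permute_list \<sigma> xs))"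
  "f \<in> Ar (PX n X) \<Longrightarrow> Far (perm_act P n X \<sigma>) f = (case f of (p, xs) \<Rightarrow> (Far (act P n \<sigma>) p, permute_list \<sigma> xs))"
  unfolding perm_act_def by simp_all

lemma sym_set_perm_act:
  "sym_set n (Ob (PX n X)) (\<lambda>\<sigma>. Fob (perm_act P n X \<sigma>))"
  "sym_set n (Ar (PX n X)) (\<lambda>\<sigma>. Far (perm_act P n X \<sigma>))"
proof -
  have cong: "sym_set n E a'"
    if "sym_set n E a" "\<And>\<sigma> x. x \<in> E \<Longrightarrow> a \<sigma> x = a' \<sigma> x"
    for E :: "('u \<times> 'u list) set" and a a'
    using that by (auto simp: sym_set_def)
  show "sym_set n (Ob (PX n X)) (\<lambda>\<sigma>. Fob (perm_act P n X \<sigma>))"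
    unfolding bprod_simps cpower_simps
    by (rule cong[OF sym_set_tuples[OF act_ob]]) (simp add: perm_act_apply)
  show "sym_set n (Ar (PX n X)) (\<lambda>\<sigma>. Far (perm_act P n X \<sigma>))"
    unfolding bprod_simps cpower_simps
    by (rule cong[OF sym_set_tuples[OF act_ar]]) (simp add: perm_act_apply)
qed

lemma quotient:
  assumes X: "category X"
  shows "sym_quotient n (PX n X) (perm_act P n X) (Tgt (q n X)) (q n X)"
proof (rule sym_quotient.intro)
  show "infinite (UNIV :: 'u set)" by (rule inf)
  show "q n X \<in> Fun (PX n X) (Tgt (q n X))" by (rule q_Fun[OF X])
  show "sym_set n (Ob (PX n X)) (\<lambda>\<sigma>. Fob (perm_act P n X \<sigma>))"
    by (rule sym_set_perm_act)
  show "sym_set n (Ar (PX n X)) (\<lambda>\<sigma>. Far (perm_act P n X \<sigma>))"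
    by (rule sym_set_perm_act)
  show R: "perm_act P n X \<sigma> \<in> Fun (PX n X) (PX n X)" if "\<sigma> \<in> Sym n" for \<sigma>
    by (rule perm_act_Fun[OF symmetric_operad_axioms PX_category[OF X] that])
  have L: "act_left P n X \<in> Fun (act_source P n X) (PX n X)" and Rt: "act_right P n X \<in> Fun (act_source P n X) (PX n X)"
    and eq: "fcomp (q n X) (act_left P n X) = fcomp (q n X) (act_right P n X)"
    using coeq[OF X, of n] by (auto simp: is_coequalizer_def Fun_def act_left_def act_right_def)
  have inv: "permute_list (inv \<sigma>) (permute_list \<sigma> xs) = xs" "permute_list \<sigma> (permute_list (inv \<sigma>) xs) = xs"
    if "\<sigma> \<in> Sym n" "length xs = n" for \<sigma> :: "nat \<Rightarrow> nat" and xs :: "'u list"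
    using that permute_list_compose[of \<sigma> xs "inv \<sigma>"] permute_list_compose[of "inv \<sigma>" xs \<sigma>]
    by (auto simp: permutes_inv_o permutes_inv simp flip: permute_list_compose)
  have src: "(p, \<sigma>, xs) \<in> Ob (act_source P n X) \<longleftrightarrow> p \<in> Ob (PC P n) \<and> \<sigma> \<in> Sym n \<and> xs \<in> tuples (Ob X) n"
    "(p, \<sigma>, xs) \<in> Ar (act_source P n X) \<longleftrightarrow> p \<in> Ar (PC P n) \<and> \<sigma> \<in> Sym n \<and> xs \<in> tuples (Ar X) n" for p \<sigma> xs
    by (auto simp: act_source_def)
  show "fcomp (q n X) (perm_act P n X \<sigma>) = q n X" if \<sigma>: "\<sigma> \<in> Sym n" for \<sigma>
  proof (rule functor_eq_of_Ar[OF fcomp_Fun[OF R[OF \<sigma>] q_Fun[OF X]] q_Fun[OF X]])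
    fix f assume f: "f \<in> Ar (PX n X)"
    then obtain p xs where [simp]: "f = (p, xs)" and *: "p \<in> Ar (PC P n)" "xs \<in> tuples (Ar X) n" by auto
    have s: "(p, \<sigma>, permute_list \<sigma> xs) \<in> Ar (act_source P n X)" using * \<sigma> by (simp add: src permute_tuples)
    have "Far (q n X) (Far (act_left P n X) (p, \<sigma>, permute_list \<sigma> xs))
      = Far (q n X) (Far (act_right P n X) (p, \<sigma>, permute_list \<sigma> xs))"
      using fcomp_eqD(2)[OF eq L s] s FunD(2)[OF Rt] by simp
    then show "Far (fcomp (q n X) (perm_act P n X \<sigma>)) f = Far (q n X) f"
      using f s * \<sigma> inv FunD(2)[OF R[OF \<sigma>]] tuplesD(1)[OF *(2)]
      by (simp add: act_left_def act_right_def perm_act_apply)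
  qed
  fix Z :: "'u cat" and h
  assume h: "h \<in> Fun (PX n X) Z" and h_inv: "\<And>\<sigma>. \<sigma> \<in> Sym n \<Longrightarrow> fcomp h (perm_act P n X \<sigma>) = h"
  have "fcomp h (act_left P n X) = fcomp h (act_right P n X)"
  proof (rule functor_eq_of_Ar[OF fcomp_Fun[OF L h] fcomp_Fun[OF Rt h]])
    fix f assume f: "f \<in> Ar (act_source P n X)"
    then obtain p \<sigma> xs where [simp]: "f = (p, \<sigma>, xs)" by (metis prod_cases3)
    have *: "p \<in> Ar (PC P n)" "\<sigma> \<in> Sym n" "xs \<in> tuples (Ar X) n" using f src by auto
    have \<sigma>': "inv \<sigma> \<in> Sym n" using * by (simp add: permutes_inv)
    have m: "(p, permute_list (inv \<sigma>) xs) \<in> Ar (PX n X)"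
      using * permute_tuples[OF *(3) \<sigma>'] by simp
    show "Far (fcomp h (act_left P n X)) f = Far (fcomp h (act_right P n X)) f"
      using fcomp_eqD(2)[OF h_inv[OF *(2)] R[OF *(2)] m] perm_act_apply(2)[OF m] inv(2)[OF *(2)] tuplesD(1)[OF *(3)] f
      by (simp add: act_left_def act_right_def)
  qed
  then show "\<exists>!k. k \<in> Fun (Tgt (q n X)) Z \<and> fcomp k (q n X) = h"
    using coeq[OF X, of n] h by (simp add: is_coequalizer_def act_left_def)
qed

lemma coprod': "category X \<Longrightarrow> coproduct (\<lambda>n. Tgt (q n X)) (T0 M X) (\<lambda>n. \<iota> n X)"
  using coprod inf by unfold_locales auto

lemma brO_eq:
  assumes X: "category X" and "p \<in> Ob (PC P n)" "xs \<in> tuples (Ob X) n" "r \<in> Ob (PC P n)" "ys \<in> tuples (Ob X) n"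
  shows "brO q \<iota> n X p xs = brO q \<iota> n X r ys \<longleftrightarrow>
    (\<exists>\<sigma>\<in>Sym n. r = Fob (act P n \<sigma>) p \<and> ys = permute_list \<sigma> xs)"
proof -
  interpret Q: sym_quotient n "PX n X" "perm_act P n X" "Tgt (q n X)" "q n X" by (rule quotient[OF X])
  interpret T: coproduct "\<lambda>n. Tgt (q n X)" "T0 M X" "\<lambda>n. \<iota> n X" by (rule coprod'[OF X])
  have m: "(p, xs) \<in> Ob (PX n X)" "(r, ys) \<in> Ob (PX n X)" using assms by auto
  have "brO q \<iota> n X p xs = brO q \<iota> n X r ys \<longleftrightarrow> Fob (q n X) (p, xs) = Fob (q n X) (r, ys)"
    unfolding brO_def
    using T.ob_inj[OF FunD(8)[OF q_Fun[OF X] m(1)] FunD(8)[OF q_Fun[OF X] m(2)]] by (rule iffI) simp_all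
  then show ?thesis
    by (simp only: Q.kernel_ob[OF m] Q.ob.orbit_eq_def perm_act_apply(1)[OF m(1)] prod.case prod.inject)
qed

context
  assumes free_actions: "\<And>n. free_action (Sym n) id (act P n) (PC P n)"
begin

lemma sym_sequence_ar: "sym_sequence (\<lambda>n. Ar (PC P n)) (\<lambda>n \<sigma>. Far (act P n \<sigma>))"
  by (rule sym_sequence.intro[OF act_ar]) (use free_actions in \<open>auto simp: free_action_def\<close>)

lemma PX_encoding: "\<exists>e :: 'u \<times> 'u list \<Rightarrow> 'u. inj_on e (S \<times> tuples S' n)"
proof -
  obtain e :: "'u list \<Rightarrow> 'u" where e: "inj_on e {xs. length xs = n}"
    using infinite_list_encoding[OF inf] by blast
  obtain d :: "'u \<Rightarrow> 'u \<times> 'u" where d: "bij d" by (rule infinite_bij_Times[OF inf])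
  have "inj_on (\<lambda>(p, xs). inv d (p, e xs)) (S \<times> tuples S' n)"
  proof (rule inj_onI, clarify)
    fix p xs r ys assume *: "xs \<in> tuples S' n" "ys \<in> tuples S' n" and "inv d (p, e xs) = inv d (r, e ys)"
    then have "p = r \<and> e xs = e ys" using bij_imp_bij_inv[OF d] by (auto dest!: bij_is_inj injD)
    then show "p = r \<and> xs = ys" using e * by (auto simp: tuples_def dest: inj_onD)
  qed
  then show ?thesis by blast
qed

lemma orbit_set_ar:
  assumes X: "category X"
  shows "orbit_set (\<lambda>n. Ar (PC P n)) (\<lambda>n \<sigma>. Far (act P n \<sigma>)) (Ar X) (Ar (T0 M X)) (\<lambda>n. brA q \<iota> n X)"
proof -
  interpret T: coproduct "\<lambda>n. Tgt (q n X)" "T0 M X" "\<lambda>n. \<iota> n X" by (rule coprod'[OF X])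
  interpret sym_sequence "\<lambda>n. Ar (PC P n)" "\<lambda>n \<sigma>. Far (act P n \<sigma>)" by (rule sym_sequence_ar)
  show ?thesis
  proof
    fix p n xs assume "p \<in> Ar (PC P n)" "xs \<in> tuples (Ar X) n"
    then show "brA q \<iota> n X p xs \<in> Ar (T0 M X)"
      using FunD(9)[OF T.inj_Fun[of n] FunD(9)[OF q_Fun[OF X, of n], of "(p, xs)"]] by (simp add: brA_def)
  next
    fix t assume "t \<in> Ar (T0 M X)"
    then obtain n f where f: "f \<in> Ar (Tgt (q n X))" "t = Far (\<iota> n X) f" using T.ar_surj by blast
    interpret Q: sym_quotient n "PX n X" "perm_act P n X" "Tgt (q n X)" "q n X" by (rule quotient[OF X])
    from f Q.ar_surj obtain m where "m \<in> Ar (PX n X)" "f = Far (q n X) m" by (metis imageE)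
    then show "\<exists>n. \<exists>p\<in>Ar (PC P n). \<exists>xs\<in>tuples (Ar X) n. t = brA q \<iota> n X p xs"
      using f by (auto simp: brA_def)
  next
    fix p n xs r m ys
    assume a: "p \<in> Ar (PC P n)" "xs \<in> tuples (Ar X) n" "r \<in> Ar (PC P m)" "ys \<in> tuples (Ar X) m"
    have "(p, xs) \<in> Ar (PX n X)" "(r, ys) \<in> Ar (PX m X)" using a by auto
    note m = this and mq = this[THEN FunD(9)[OF q_Fun[OF X]]]
    show "brA q \<iota> n X p xs = brA q \<iota> m X r ys \<longleftrightarrow>
      n = m \<and> (\<exists>\<sigma>\<in>Sym n. r = Far (act P n \<sigma>) p \<and> ys = permute_list \<sigma> xs)"
    proof (cases "n = m")
      case False
      then show ?thesis using T.ar_disjoint[OF mq] by (auto simp: brA_def)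
    next
      case True
      interpret Q: sym_quotient n "PX n X" "perm_act P n X" "Tgt (q n X)" "q n X" by (rule quotient[OF X])
      have fr: "\<sigma> = id" if "\<sigma> \<in> Sym n" "x \<in> Ob (PX n X)" "Fob (perm_act P n X \<sigma>) x = x" for \<sigma> x
        using free_actions[of n] that perm_act_apply(1)[OF that(2)] by (auto simp: free_action_def split: prod.splits)
      obtain eo :: "'u \<times> 'u list \<Rightarrow> 'u" where eo: "inj_on eo (Ob (PX n X))"
        unfolding bprod_simps cpower_simps using PX_encoding by blast
      obtain ea :: "'u \<times> 'u list \<Rightarrow> 'u" where ea: "inj_on ea (Ar (PX n X))"
        unfolding bprod_simps cpower_simps using PX_encoding by blast
      have "brA q \<iota> n X p xs = brA q \<iota> m X r ys \<longleftrightarrow> Far (q n X) (p, xs) = Far (q n X) (r, ys)"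
        using T.ar_inj mq True by (auto simp: brA_def)
      also have "\<dots> \<longleftrightarrow> Q.ar.orbit_eq (p, xs) (r, ys)"
        by (rule Q.kernel_ar[OF _ eo ea m(1)]) (use fr m(2) True in auto)
      also have "\<dots> \<longleftrightarrow> (\<exists>\<sigma>\<in>Sym n. r = Far (act P n \<sigma>) p \<and> ys = permute_list \<sigma> xs)"
        by (simp only: Q.ar.orbit_eq_def perm_act_apply(2)[OF m(1)] prod.case prod.inject)
      finally show ?thesis using True by simp
    qed
  qed
qed

lemma orbit_map_ar:
  assumes F: "F \<in> Fun X Y"
  shows "orbit_map (\<lambda>n. Ar (PC P n)) (\<lambda>n \<sigma>. Far (act P n \<sigma>)) (Ar X) (Ar (T0 M X)) (\<lambda>n. brA q \<iota> n X)
    (Ar Y) (Ar (T0 M Y)) (\<lambda>n. brA q \<iota> n Y) (Far F) (Far (T1 M F))"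
  unfolding orbit_map_def orbit_map_axioms_def
  using orbit_set_ar[OF FunD(4)[OF F]] orbit_set_ar[OF FunD(5)[OF F]] FunD(9)[OF F] T1_ar[OF F]
  by auto

lemma T1_comp:
  assumes h: "h \<in> Fun W A" and f: "f \<in> Fun A D" and k: "k \<in> Fun W B" and g: "g \<in> Fun B D"
    and eq: "fcomp f h = fcomp g k"
  shows "fcomp (T1 M f) (T1 M h) = fcomp (T1 M g) (T1 M k)"
proof (rule functor_eq_of_Ar[OF fcomp_Fun[OF T1_fun[OF h] T1_fun[OF f]] fcomp_Fun[OF T1_fun[OF k] T1_fun[OF g]]])
  interpret h: orbit_map "\<lambda>n. Ar (PC P n)" "\<lambda>n \<sigma>. Far (act P n \<sigma>)" "Ar W" "Ar (T0 M W)" "\<lambda>n. brA q \<iota> n W"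
    "Ar A" "Ar (T0 M A)" "\<lambda>n. brA q \<iota> n A" "Far h" "Far (T1 M h)" by (rule orbit_map_ar[OF h])
  interpret k: orbit_map "\<lambda>n. Ar (PC P n)" "\<lambda>n \<sigma>. Far (act P n \<sigma>)" "Ar W" "Ar (T0 M W)" "\<lambda>n. brA q \<iota> n W"
    "Ar B" "Ar (T0 M B)" "\<lambda>n. brA q \<iota> n B" "Far k" "Far (T1 M k)" by (rule orbit_map_ar[OF k])
  interpret f: orbit_map "\<lambda>n. Ar (PC P n)" "\<lambda>n \<sigma>. Far (act P n \<sigma>)" "Ar A" "Ar (T0 M A)" "\<lambda>n. brA q \<iota> n A"
    "Ar D" "Ar (T0 M D)" "\<lambda>n. brA q \<iota> n D" "Far f" "Far (T1 M f)" by (rule orbit_map_ar[OF f])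
  interpret g: orbit_map "\<lambda>n. Ar (PC P n)" "\<lambda>n \<sigma>. Far (act P n \<sigma>)" "Ar B" "Ar (T0 M B)" "\<lambda>n. brA q \<iota> n B"
    "Ar D" "Ar (T0 M D)" "\<lambda>n. brA q \<iota> n D" "Far g" "Far (T1 M g)" by (rule orbit_map_ar[OF g])
  fix t assume t: "t \<in> Ar (T0 M W)"
  then obtain n p xs where *: "p \<in> Ar (PC P n)" "xs \<in> tuples (Ar W) n" "t = brA q \<iota> n W p xs"
    using h.dom.class_surj by blast
  have "map (Far f) (map (Far h) xs) = map (Far g) (map (Far k) xs)"
    using fcomp_eqD(2)[OF eq h] FunD(2)[OF k] tuplesD(2)[OF *(2)] by (auto simp: subset_iff)
  then show "Far (fcomp (T1 M f) (T1 M h)) t = Far (fcomp (T1 M g) (T1 M k)) t"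
    using t * FunD(2)[OF T1_fun[OF h]] FunD(2)[OF T1_fun[OF k]] map_tuples[OF *(2) h.map_in] map_tuples[OF *(2) k.map_in]
    by (simp add: h.map_class k.map_class f.map_class g.map_class del: map_map)
qed

lemma T1_pullback:
  assumes pb: "two_pullback h k f g"
  shows "two_pullback (T1 M h) (T1 M k) (T1 M f) (T1 M g)"
proof -
  have F: "h \<in> Fun (Src h) (Src f)" "k \<in> Fun (Src h) (Src g)" "f \<in> Fun (Src f) (Tgt f)" "g \<in> Fun (Src g) (Tgt f)"
    using pb by (auto simp: two_pullback_def Fun_def)
  interpret arrow_pullback "Src h" "Src f" "Src g" "Tgt f" h k f g
    using pb two_pullback_iff[OF inf F] by simp
  show ?thesis
    unfolding two_pullback_iff[OF inf F[THEN T1_fun]]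
  proof (intro arrow_pullback.intro F[THEN T1_fun] T1_comp[OF F(1,3,2,4) commute])
    show "pullback_on (Ar (T0 M (Src h))) (Ar (T0 M (Src f))) (Ar (T0 M (Src g)))
      (Far (T1 M h)) (Far (T1 M k)) (Far (T1 M f)) (Far (T1 M g))"
      by (rule orbit_pullback[OF F[THEN orbit_map_ar] commute_ar arrows])
  qed
qed

lemma eta_pullback:
  assumes F: "F \<in> Fun X Y"
  shows "two_pullback F (eta M X) (eta M Y) (T1 M F)"
proof -
  have X: "category X" and Y: "category Y" using F by (rule FunD)+
  interpret F: orbit_map "\<lambda>n. Ar (PC P n)" "\<lambda>n \<sigma>. Far (act P n \<sigma>)" "Ar X" "Ar (T0 M X)" "\<lambda>n. brA q \<iota> n X"
    "Ar Y" "Ar (T0 M Y)" "\<lambda>n. brA q \<iota> n Y" "Far F" "Far (T1 M F)" by (rule orbit_map_ar[OF F])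
  note fn = F eta_fun[OF X] eta_fun[OF Y] T1_fun[OF F]
  have e: "Idt (PC P 1) (opid P) \<in> Ar (PC P 1)" using opid_in by (simp add: category.idt_in[OF PC_cat])
  show ?thesis
    unfolding two_pullback_iff[OF inf fn]
  proof (intro arrow_pullback.intro fn)
    show "fcomp (eta M Y) F = fcomp (T1 M F) (eta M X)"
    proof (rule functor_eq_of_Ar[OF fcomp_Fun[OF fn(1,3)] fcomp_Fun[OF fn(2,4)]])
      fix f assume f: "f \<in> Ar X"
      then show "Far (fcomp (eta M Y) F) f = Far (fcomp (T1 M F) (eta M X)) f"
        using F.map_class[OF e, of "[f]"] FunD(2)[OF fn(1)] FunD(2)[OF fn(2)] FunD(9)[OF F f]
        by (simp add: eta_ar X Y tuples_def)
    qed
    show "pullback_on (Ar X) (Ar Y) (Ar (T0 M X)) (Far F) (Far (eta M X)) (Far (eta M Y)) (Far (T1 M F))"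
      by (rule orbit_unit_pullback[OF F.orbit_map_axioms e]) (simp_all add: eta_ar X Y)
  qed
qed

lemma mult_pullback:
  assumes F: "F \<in> Fun X Y"
  shows "two_pullback (T1 M (T1 M F)) (mult M X) (mult M Y) (T1 M F)"
proof -
  have X: "category X" and Y: "category Y" using F by (rule FunD)+
  let ?mu = "\<lambda>ks p ps. Far (opmu P ks) (p, ps)"
  interpret F: orbit_map "\<lambda>n. Ar (PC P n)" "\<lambda>n \<sigma>. Far (act P n \<sigma>)" "Ar X" "Ar (T0 M X)" "\<lambda>n. brA q \<iota> n X"
    "Ar Y" "Ar (T0 M Y)" "\<lambda>n. brA q \<iota> n Y" "Far F" "Far (T1 M F)" by (rule orbit_map_ar[OF F])
  interpret TF: orbit_map "\<lambda>n. Ar (PC P n)" "\<lambda>n \<sigma>. Far (act P n \<sigma>)" "Ar (T0 M X)" "Ar (T0 M (T0 M X))"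
    "\<lambda>n. brA q \<iota> n (T0 M X)" "Ar (T0 M Y)" "Ar (T0 M (T0 M Y))" "\<lambda>n. brA q \<iota> n (T0 M Y)"
    "Far (T1 M F)" "Far (T1 M (T1 M F))" by (rule orbit_map_ar[OF T1_fun[OF F]])
  note fn = T1_fun[OF T1_fun[OF F]] mult_fun[OF X] mult_fun[OF Y] T1_fun[OF F]
  have mu_in: "?mu ks p ps \<in> Ar (PC P (sum_list ks))"
    if "p \<in> Ar (PC P (length ks))" "list_all2 (\<lambda>p k. p \<in> Ar (PC P k)) ps ks" for ks p ps
    by (rule FunD(9)[OF opmu_fun]) (use that in \<open>simp add: lprod_def list_all2_map2\<close>)
  have mu: "Far (mult M Z) (brA q \<iota> (length ks) (T0 M Z) p
      (map (\<lambda>i. brA q \<iota> (ks ! i) Z (ps ! i) (xss ! i)) [0..<length ks]))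
      = brA q \<iota> (sum_list ks) Z (?mu ks p ps) (concat xss)"
    if "category Z" "p \<in> Ar (PC P (length ks))" "list_all2 (\<lambda>p k. p \<in> Ar (PC P k)) ps ks"
      "list_all2 (\<lambda>xs k. xs \<in> tuples (Ar Z) k) xss ks" for Z ks p ps xss
    by (rule mult_ar) (use that in \<open>simp_all add: lprod_def list_all2_map2 flip: cpower_simps\<close>)
  show ?thesis
    unfolding two_pullback_iff[OF inf fn]
  proof (intro arrow_pullback.intro fn)
    show "fcomp (mult M Y) (T1 M (T1 M F)) = fcomp (T1 M F) (mult M X)"
    proof (rule functor_eq_of_Ar[OF fcomp_Fun[OF fn(1,3)] fcomp_Fun[OF fn(2,4)]])
      fix t assume t: "t \<in> Ar (T0 M (T0 M X))"
      then obtain n p ss where ss: "p \<in> Ar (PC P n)" "ss \<in> tuples (Ar (T0 M X)) n" "t = brA q \<iota> n (T0 M X) p ss"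
        using TF.dom.class_surj by blast
      obtain ks ps xss where d: "length ks = n" "list_all2 (\<lambda>p k. p \<in> Ar (PC P k)) ps ks"
        "list_all2 (\<lambda>xs k. xs \<in> tuples (Ar X) k) xss ks"
        "ss = map (\<lambda>i. brA q \<iota> (ks ! i) X (ps ! i) (xss ! i)) [0..<length ks]"
        by (rule F.dom.class_list[OF ss(2)])
      have p: "p \<in> Ar (PC P (length ks))" using ss d by simp
      have len: "length xss = length ks" using d by (simp add: list_all2_lengthD)
      have yss: "list_all2 (\<lambda>xs k. xs \<in> tuples (Ar Y) k) (map (map (Far F)) xss) ks"
        using d(3) F.map_in by (auto simp: list_all2_conv_all_nth intro: map_tuples)
      have "map (Far (T1 M F)) ss = map (\<lambda>i. brA q \<iota> (ks ! i) Y (ps ! i) (map (map (Far F)) xss ! i)) [0..<length ks]"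
        unfolding d(4) map_map
        by (rule map_cong) (use d(2,3) in \<open>auto simp: list_all2_conv_all_nth F.map_class\<close>)
      then have "Far (T1 M (T1 M F)) t = brA q \<iota> (length ks) (T0 M Y) p
          (map (\<lambda>i. brA q \<iota> (ks ! i) Y (ps ! i) (map (map (Far F)) xss ! i)) [0..<length ks])"
        using ss d(1) by (simp add: TF.map_class)
      then have "Far (mult M Y) (Far (T1 M (T1 M F)) t)
          = brA q \<iota> (sum_list ks) Y (?mu ks p ps) (map (Far F) (concat xss))"
        by (simp only: mu[OF Y p d(2) yss] map_concat)
      also have "\<dots> = Far (T1 M F) (brA q \<iota> (sum_list ks) X (?mu ks p ps) (concat xss))"
        using F.map_class[OF mu_in[OF p d(2)] concat_tuples[OF d(3)]] by simp
      also have "\<dots> = Far (T1 M F) (Far (mult M X) t)"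
        using mu[OF X p d(2,3)] ss(3) d(1,4) by simp
      finally show "Far (fcomp (mult M Y) (T1 M (T1 M F))) t = Far (fcomp (T1 M F) (mult M X)) t"
        using t FunD(2)[OF fn(1)] FunD(2)[OF fn(2)] by simp
    qed
    show "pullback_on (Ar (T0 M (T0 M X))) (Ar (T0 M (T0 M Y))) (Ar (T0 M X))
      (Far (T1 M (T1 M F))) (Far (mult M X)) (Far (mult M Y)) (Far (T1 M F))"
      by (rule orbit_mult_pullback[OF F.orbit_map_axioms TF.orbit_map_axioms, of ?mu])
         (simp_all only: mu_in mu[OF X] mu[OF Y])
  qed
qed

lemma free_imp_two_cartesian: "two_cartesian M"
  unfolding two_cartesian_def using T1_pullback eta_pullback mult_pullback by blast

end

text \<open>
  If \<open>p \<cdot> \<sigma> = p\<close>, then for distinct \<open>x\<^sub>i\<close> the elements \<open>[p; (x\<^sub>i, x\<^sub>i)]\<close> and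
  \<open>[p; (x\<^sub>i, x\<^bsub>\<sigma> i\<^esub>)]\<close> of \<open>T (X \<times> X)\<close> have the same two projections \<open>[p; x]\<close> in \<open>T X\<close>, so they are equal
  if \<open>T\<close> preserves the product \<open>X \<times> X\<close>, regarded as a pullback over a point. We take \<open>X\<close> discrete
  on the whole universe, which also carries \<open>X \<times> X\<close> through a bijection.
\<close>

lemma preserves_pullbacks_imp_free_ob:
  assumes pres: "\<And>h k f g. two_pullback h k f g \<Longrightarrow> two_pullback (T1 M h) (T1 M k) (T1 M f) (T1 M g)"
    and \<sigma>: "\<sigma> \<in> Sym n" and p: "p \<in> Ob (PC P n)" and fix_p: "Fob (act P n \<sigma>) p = p"
  shows "\<sigma> = id"
proof -
  obtain d :: "'u \<Rightarrow> 'u \<times> 'u" where d: "bij d" by (rule infinite_bij_Times[OF inf])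
  have [simp]: "d (inv d y) = y" for y using d by (simp add: bij_is_surj surj_f_inv_f)
  obtain c :: "nat \<Rightarrow> 'u" where c: "inj c" using infinite_countable_subset[OF inf] by blast
  let ?X = "discrete (UNIV :: 'u set)" and ?I = "discrete {c 0}"
  let ?h = "mk_functor ?X ?X (fst \<circ> d) (fst \<circ> d)" and ?k = "mk_functor ?X ?X (snd \<circ> d) (snd \<circ> d)"
  let ?t = "mk_functor ?X ?I (\<lambda>_. c 0) (\<lambda>_. c 0)"
  have h: "?h \<in> Fun ?X ?X" and k: "?k \<in> Fun ?X ?X" and t: "?t \<in> Fun ?X ?I"
    by (rule discrete_Fun, simp)+
  have X: "category ?X" by (rule discrete_category)
  have "two_pullback ?h ?k ?t ?t"
    unfolding two_pullback_iff[OF inf h k t t]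
  proof (intro arrow_pullback.intro h k t)
    show "fcomp ?t ?h = fcomp ?t ?k"
      by (rule functor_eq_of_Ar[OF fcomp_Fun[OF h t] fcomp_Fun[OF k t]]) simp
    show "pullback_on (Ar ?X) (Ar ?X) (Ar ?X) (Far ?h) (Far ?k) (Far ?t) (Far ?t)"
    proof (rule pullback_onI)
      fix x y
      show "\<exists>w\<in>Ar ?X. Far ?h w = x \<and> Far ?k w = y" by (rule bexI[of _ "inv d (x, y)"]) simp_all
    next
      fix w w' assume "Far ?h w = Far ?h w'" "Far ?k w = Far ?k w'"
      then have "d w = d w'" by (simp add: prod_eq_iff)
      then show "w = w'" by (rule injD[OF bij_is_inj[OF d]])
    qed
  qed
  then have "two_pullback (T1 M ?h) (T1 M ?k) (T1 M ?t) (T1 M ?t)" by (rule pres)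
  then interpret T: arrow_pullback "T0 M ?X" "T0 M ?X" "T0 M ?X" "T0 M ?I" "T1 M ?h" "T1 M ?k" "T1 M ?t" "T1 M ?t"
    using two_pullback_iff[OF inf h[THEN T1_fun] k[THEN T1_fun] t[THEN T1_fun] t[THEN T1_fun]] by simp
  interpret C: coproduct "\<lambda>n. Tgt (q n ?X)" "T0 M ?X" "\<lambda>n. \<iota> n ?X" by (rule coprod'[OF X])
  let ?c = "map c [0..<n]"
  let ?u = "map (\<lambda>i. inv d (c i, c i)) [0..<n]" and ?v = "map (\<lambda>i. inv d (c i, c (\<sigma> i))) [0..<n]"
  have tup: "xs \<in> tuples UNIV n \<longleftrightarrow> length xs = n" for xs :: "'u list" by (simp add: tuples_def)
  have ob: "(p, xs) \<in> Ob (PX n ?X)" if "length xs = n" for xs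
    using p that by (simp add: tup)
  have br: "brO q \<iota> n ?X p xs \<in> Ob (T0 M ?X)" if "length xs = n" for xs
    unfolding brO_def by (rule FunD(8)[OF C.inj_Fun FunD(8)[OF q_Fun[OF X] ob[OF that]]])
  have perm: "permute_list \<sigma> ?c = map (\<lambda>i. c (\<sigma> i)) [0..<n]"
    using \<sigma> by (auto simp: permute_list_def permutes_in_image[of \<sigma> "{..<n}", simplified] intro!: nth_equalityI)
  have "brO q \<iota> n ?X p ?c = brO q \<iota> n ?X p (permute_list \<sigma> ?c)"
    using brO_eq[OF X p _ p, of ?c "permute_list \<sigma> ?c"] \<sigma> fix_p by (auto simp: tup)
  moreover have Fob: "Fob ?h = fst \<circ> d" "Fob ?k = snd \<circ> d" by (simp_all add: mk_functor_def fun_eq_iff)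
  ultimately have k_eq: "Fob (T1 M ?k) (brO q \<iota> n ?X p ?u) = Fob (T1 M ?k) (brO q \<iota> n ?X p ?v)"
    by (simp only: T1_ob[OF k ob] length_map length_upt minus_nat.diff_0 Fob) (simp add: perm comp_def)
  have h_eq: "Fob (T1 M ?h) (brO q \<iota> n ?X p ?u) = Fob (T1 M ?h) (brO q \<iota> n ?X p ?v)"
    by (simp only: T1_ob[OF h ob] length_map length_upt minus_nat.diff_0 Fob) (simp add: comp_def)
  have "brO q \<iota> n ?X p ?u = brO q \<iota> n ?X p ?v"
    by (rule T.ob_unique[OF br br h_eq k_eq]) simp_all
  then obtain \<tau> where \<tau>: "\<tau> permutes {..<n}" "?v = permute_list \<tau> ?u"
    using brO_eq[OF X p _ p, of ?u ?v] by (auto simp: tup)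
  have "\<sigma> i = i" if i: "i < n" for i
  proof -
    have \<tau>i: "\<tau> i < n" using permutes_in_image[OF \<tau>(1), of i] i by simp
    have "?v ! i = ?u ! \<tau> i" unfolding \<tau>(2) using \<tau>(1) i by (simp add: permute_list_nth)
    then have "inv d (c i, c (\<sigma> i)) = inv d (c (\<tau> i), c (\<tau> i))" using i \<tau>i by simp
    then have "d (inv d (c i, c (\<sigma> i))) = d (inv d (c (\<tau> i), c (\<tau> i)))" by (rule arg_cong)
    then show ?thesis using c by (auto simp: inj_eq)
  qed
  moreover have "\<sigma> i = i" if "\<not> i < n" for i using \<sigma> that by (auto intro: permutes_not_in)
  ultimately show ?thesis by (auto simp: fun_eq_iff)
qed

lemma two_cartesian_imp_free:
  assumes "two_cartesian M"
  shows "free_action (Sym n) id (act P n) (PC P n)"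
  unfolding free_action_def
proof (intro ballI impI)
  have pres: "two_pullback (T1 M h) (T1 M k) (T1 M f) (T1 M g)" if "two_pullback h k f g" for h k f g
    using assms that unfolding two_cartesian_def by blast
  fix \<sigma> assume \<sigma>: "\<sigma> \<in> Sym n"
    and "(\<exists>x\<in>Ob (PC P n). Fob (act P n \<sigma>) x = x) \<or> (\<exists>f\<in>Ar (PC P n). Far (act P n \<sigma>) f = f)"
  then obtain x where x: "x \<in> Ob (PC P n)" "Fob (act P n \<sigma>) x = x"
    using FunD(10)[OF act_fun[OF \<sigma>]] category.dom_in[OF PC_cat] by metis
  show "\<sigma> = id" by (rule preserves_pullbacks_imp_free_ob) (fact pres \<sigma> x)+
qed

end

theorem corollary14p7:
  fixes P :: "'u operad" and M :: "'u two_monad"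
    and q :: "nat \<Rightarrow> 'u cat \<Rightarrow> ('u \<times> 'u list, 'u) cfunctor"
    and \<iota> :: "nat \<Rightarrow> 'u cat \<Rightarrow> ('u, 'u) cfunctor"
  assumes "infinite (UNIV :: 'u set)"
    and "symmetric_operad P"
    and "operad_two_monad P q \<iota> M"
  shows "two_cartesian M \<longleftrightarrow>
    (\<forall>n. free_action {\<sigma>. \<sigma> permutes {..<n}} id (act P n) (PC P n))"
proof -
  interpret operad_monad P q \<iota> M
    using assms by (intro operad_monad.intro operad_monad_axioms.intro)
  show ?thesis using two_cartesian_imp_free free_imp_two_cartesian by blast
qed

end
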